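(* Let $\Theta$, $f_1,\dots,f_m$, $w\in\Delta_m$, $\mathrm{TCH}(\cdot\,;w)$, the constants $U,L,R_\theta$, the stochastic gradients, the iterates $(\theta^{(t)},\lambda^{(t)})_{t=1}^T$ of online mirror descent with distance-generating functions $\psi_\theta,\psi_\lambda$ and step sizes $\eta_\theta,\eta_\lambda$, and the constants $D_\theta,D_\lambda,C_\theta,C_\lambda$ be as in the context. In particular each $f_i$ is convex with $f_i\le U$ and $\|\nabla f_i\|_\infty\le L$ on $\Theta$, and $\|\theta\|_\infty\le R_\theta$ for all $\theta\in\Theta$. Suppose that (1) $\psi_\theta$ is $\mu_\theta$-strongly convex, (2) $\psi_\lambda$ is $\mu_\lambda$-strongly convex, (3) $\eta_\theta=\sqrt{\frac{4\mu_\theta D_\theta}{5TC_\theta L^2}}$, and (4) $\eta_\lambda=\sqrt{\frac{4\mu_\lambda D_\lambda}{5TC_\lambda U^2}}$. Let $\hat\theta$ be either the uniformly averaged output $\bar\theta$ or the adaptively averaged output $\tilde\theta$. Then for every $0<\gamma<1$, with probability at least $1-\gamma$ (over the stochastic gradients), $$\mathrm{TCH}(\hat\theta;w)-\min_{\theta\in\Theta}\mathrm{TCH}(\theta;w)\le\sqrt{\frac{20D_\theta C_\theta L^2}{\mu_\theta T}}+\sqrt{\frac{20D_\lambda C_\lambda U^2}{\mu_\lambda T}}+4(dR_\theta L+U)\sqrt{\frac{2}{T}\log\frac1\gamma}.$$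
   Context: Problem. $d,m,T\ge1$ are integers, $\Delta_m=\{\alpha\in\mathbb{R}^m:\sum_i\alpha_i=1,\ \alpha_i\ge0\}$. $\Theta\subset\mathbb{R}^d$ is nonempty, closed and convex; $f_1,\dots,f_m:\mathbb{R}^d\to\mathbb{R}$ are differentiable and nonnegative on $\Theta$. For $w\in\Delta_m$, $\mathrm{TCH}(\theta;w)=\max_{i\in[m]}w_if_i(\theta)$ and $\mathcal{L}(\theta,\lambda;w)=\sum_{i=1}^m\lambda_iw_if_i(\theta)$ for $\lambda\in\Delta_m$. Assumption. There are constants $U,L,R_\theta>0$ such that for all $i\in[m]$ and $\theta\in\Theta$: $f_i$ is convex on $\Theta$, $f_i(\theta)\le U$, $\|\nabla f_i(\theta)\|_\infty\le L$, $\|\theta\|_\infty\le R_\theta$. Stochastic gradients. In each round $t$, for each objective $i$ a random batch of its training data is drawn (fresh in each round), giving random estimates $\delta f_i(\theta^{(t)})\in\mathbb{R}^d$ of $\nabla f_i(\theta^{(t)})$ and $\hat f_i^{(t)}\in\mathbb{R}$ of $f_i(\theta^{(t)})$ (batch averages of per-sample gradients and losses), whose conditional expectations given all batches of rounds $1,\dots,t-1$ are $\nabla f_i(\theta^{(t)})$ and $f_i(\theta^{(t)})$. Put $g_\theta^{(t)}=\sum_i\lambda_i^{(t)}w_i\,\delta f_i(\theta^{(t)})$ and $g_\lambda^{(t)}=(w_i\hat f_i^{(t)})_{i=1}^m$; these are conditionally unbiased for $\nabla_\theta\mathcal{L}(\theta^{(t)},\lambda^{(t)};w)$ and $\nabla_\lambda\mathcal{L}(\theta^{(t)},\lambda^{(t)};w)$,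 and $\|g_\theta^{(t)}\|_\infty\le L$, $\|g_\lambda^{(t)}\|_\infty\le U$. Online mirror descent. For $X\in\{\Theta,\Delta_m\}$, the distance-generating function $\psi:X\to\mathbb{R}$ is continuous, and $\mu$-strongly convex with respect to some norm; $X^\circ\subset X$ is a set such that $\psi$ extends to a continuously differentiable function on a neighbourhood of $X^\circ$. The Bregman divergence is $B_\psi(x;y)=\psi(x)-\psi(y)-\langle\nabla\psi(y),x-y\rangle$ for $x\in X$, $y\in X^\circ$. It is assumed that for all $y\in X^\circ$, vectors $g$ and $\eta>0$, the minimizer over $x\in X$ of $\langle g,x\rangle+\frac1\eta B_\psi(x;y)$ lies in $X^\circ$. Write $\psi_\theta,\mu_\theta,\|\cdot\|_\theta$ for $X=\Theta$ and $\psi_\lambda,\mu_\lambda,\|\cdot\|_\lambda$ for $X=\Delta_m$; $\|\cdot\|_{\theta,*}$, $\|\cdot\|_{\lambda,*}$ are the dual norms. Starting from a deterministic $\theta^{(1)}\in\Theta^\circ$ and $\lambda^{(1)}=(1/m,\dots,1/m)\in\Delta_m^\circ$, for $t=1,\dots,T$: $$\theta^{(t+1)}=\arg\min_{\theta\in\Theta}\langle g_\theta^{(t)},\theta\rangle+\tfrac1{\eta_\theta}B_{\psi_\theta}(\theta;\theta^{(t)}),\qquad\lambda^{(t+1)}=\arg\max_{\lambda\in\Delta_m}\langle g_\lambda^{(t)},\lambda\rangle-\tfrac1{\eta_\lambda}B_{\psi_\lambda}(\lambda;\lambda^{(t)}).$$ Outputs. The uniform conversion (OMD-TCH) outputs $\bar\theta=\frac1T\sum_{t=1}^T\theta^{(t)}$.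 Adaptive conversion (AdaOMD-TCH): say $\theta\preceq\theta'$ ($\theta$ dominates $\theta'$) if $f_i(\theta)\le f_i(\theta')$ for all $i$ and $f_j(\theta)<f_j(\theta')$ for some $j$. Maintain a set $P^{(t)}$ of iterates with weights $\gamma^{(t)}$, starting from $P^{(0)}=\emptyset$. In round $t$ let $A=\{\theta^{(\tau)}\in P^{(t-1)}:\theta^{(\tau)}\preceq\theta^{(t)}\}$. If $A\neq\emptyset$, keep $P^{(t)}=P^{(t-1)}$ and the weights, except that each element of $A$ has its weight increased by $1/|A|$. If $A=\emptyset$, let $B=\{\theta^{(\tau)}\in P^{(t-1)}:\theta^{(t)}\preceq\theta^{(\tau)}\}$, remove $B$ from the set, and add $\theta^{(t)}$ with weight $1$ plus the sum of the weights of the elements of $B$. Iterates are indexed by their round, and dominance uses the true objectives. The output is $\tilde\theta=\frac1T\sum_{\theta^{(\tau)}\in P^{(T)}}\gamma_\tau^{(T)}\theta^{(\tau)}$. Constants. With $\bar\lambda=\frac1T\sum_{t=1}^T\lambda^{(t)}$, let $\theta^*\in\arg\min_{\theta\in\Theta}\mathcal{L}(\theta,\bar\lambda;w)$ and $\lambda^*\in\arg\max_{\lambda\in\Delta_m}\mathcal{L}(\hat\theta,\lambda;w)$. $D_\theta,D_\lambda,C_\theta,C_\lambda>0$ are (deterministic) constants depending on $\psi_\theta,\psi_\lambda$ such that $B_{\psi_\theta}(\theta^*;\theta^{(1)})\le D_\theta$, $B_{\psi_\lambda}(\lambda^*;\lambda^{(1)})\le D_\lambda$, and for all $t$: $\|\nabla_\theta\mathcal{L}(\theta^{(t)},\lambda^{(t)};w)\|_{\theta,*}^2\le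 C_\theta L^2$, $\|g_\theta^{(t)}\|_{\theta,*}^2\le C_\theta L^2$, $\|\nabla_\lambda\mathcal{L}(\theta^{(t)},\lambda^{(t)};w)\|_{\lambda,*}^2\le C_\lambda U^2$, $\|g_\lambda^{(t)}\|_{\lambda,*}^2\le C_\lambda U^2$. *)

theory Defs
  imports "HOL-Probability.Probability"
begin

definition gradient :: "('a::real_inner \<Rightarrow> real) \<Rightarrow> 'a \<Rightarrow> 'a"
  where "gradient f x = (THE D. GDERIV f x :> D)"


subsection \<open>Multi-objective problem\<close>

definition prob_simplex :: "(real ^ 'm::finite) set"
  where "prob_simplex = {\<alpha>. (\<Sum>i\<in>UNIV. \<alpha> $ i) = 1 \<and> (\<forall>i. 0 \<le> \<alpha> $ i)}"

definition TCH :: "('m::finite \<Rightarrow> 'a \<Rightarrow> real) \<Rightarrow> real ^ 'm \<Rightarrow> 'a \<Rightarrow> real"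
  where "TCH f w \<theta> = (MAX i. w $ i * f i \<theta>)"

definition lagrangian :: "('m::finite \<Rightarrow> 'a \<Rightarrow> real) \<Rightarrow> real ^ 'm \<Rightarrow> 'a \<Rightarrow> real ^ 'm \<Rightarrow> real"
  where "lagrangian f w \<theta> l = (\<Sum>i\<in>UNIV. l $ i * w $ i * f i \<theta>)"

definition dominates :: "('m \<Rightarrow> 'a \<Rightarrow> real) \<Rightarrow> 'a \<Rightarrow> 'a \<Rightarrow> bool"
  where "dominates f \<theta> \<theta>' \<longleftrightarrow> (\<forall>i. f i \<theta> \<le> f i \<theta>') \<and> (\<exists>j. f j \<theta> < f j \<theta>')"


subsection \<open>Norms and strong convexity\<close>

text \<open>The norms of mirror descent are arbitrary norms on the underlying vector space, not the
  canonical one of its type.\<close>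

definition is_norm :: "('a::real_vector \<Rightarrow> real) \<Rightarrow> bool"
  where "is_norm N \<longleftrightarrow>
    (\<forall>x. 0 \<le> N x) \<and> (\<forall>x. N x = 0 \<longleftrightarrow> x = 0) \<and>
    (\<forall>a x. N (a *\<^sub>R x) = \<bar>a\<bar> * N x) \<and> (\<forall>x y. N (x + y) \<le> N x + N y)"

definition dual_norm :: "('a::real_inner \<Rightarrow> real) \<Rightarrow> 'a \<Rightarrow> real"
  where "dual_norm N g = (SUP x\<in>{x. N x \<le> 1}. g \<bullet> x)"

definition strongly_convex_on ::
    "'a::real_vector set \<Rightarrow> ('a \<Rightarrow> real) \<Rightarrow> real \<Rightarrow> ('a \<Rightarrow> real) \<Rightarrow> bool"
  where "strongly_convex_on X N \<mu> \<psi> \<longleftrightarrow>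
    (\<forall>x\<in>X. \<forall>y\<in>X. \<forall>a\<in>{0..1}.
       \<psi> (a *\<^sub>R x + (1 - a) *\<^sub>R y)
         \<le> a * \<psi> x + (1 - a) * \<psi> y - \<mu> / 2 * a * (1 - a) * (N (x - y))\<^sup>2)"


subsection \<open>Online mirror descent\<close>

definition bregman :: "('a::real_inner \<Rightarrow> real) \<Rightarrow> 'a \<Rightarrow> 'a \<Rightarrow> real"
  where "bregman \<psi> x y = \<psi> x - \<psi> y - gradient \<psi> y \<bullet> (x - y)"

text \<open>A distance-generating function \<open>\<psi>\<close> on \<open>X\<close> is a total function here: on a neighbourhood \<open>W\<close>
  of \<open>X0\<close> its values outside \<open>X\<close> are those of the continuously differentiable extension, so
  \<^const>\<open>gradient\<close> is the gradient of that extension. (For \<open>x \<in> X\<close> and \<open>y \<in> X0\<close> with \<open>X\<close> convex,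
  \<^const>\<open>bregman\<close> does not depend on the choice of the extension.)\<close>

definition distance_generating :: "'a::real_inner set \<Rightarrow> 'a set \<Rightarrow> ('a \<Rightarrow> real) \<Rightarrow> bool"
  where "distance_generating X X0 \<psi> \<longleftrightarrow>
    X0 \<subseteq> X \<and> continuous_on X \<psi> \<and>
    (\<exists>W. open W \<and> X0 \<subseteq> W \<and> (\<forall>x\<in>W. \<psi> differentiable (at x)) \<and> continuous_on W (gradient \<psi>))"

definition prox_closed :: "'a::real_inner set \<Rightarrow> 'a set \<Rightarrow> ('a \<Rightarrow> real) \<Rightarrow> bool"
  where "prox_closed X X0 \<psi> \<longleftrightarrow>
    (\<forall>y\<in>X0. \<forall>g. \<forall>\<eta>>0. \<forall>x.
       is_arg_min (\<lambda>x. g \<bullet> x + 1 / \<eta> * bregman \<psi> x y) (\<lambda>x. x \<in> X) x \<longrightarrow> x \<in> X0)"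


subsection \<open>Stochastic gradients\<close>

text \<open>The sigma-algebra generated by the batches of all objectives in rounds \<open>1, \<dots>, n\<close>.\<close>

definition batch_history ::
    "'w measure \<Rightarrow> ('m \<Rightarrow> 'z measure) \<Rightarrow> (nat \<Rightarrow> 'm \<Rightarrow> 'w \<Rightarrow> 'z) \<Rightarrow> nat \<Rightarrow> 'w measure"
  where "batch_history M Z batch n =
    sigma (space M) {batch s i -` A \<inter> space M | s i A. s \<in> {1..n} \<and> A \<in> sets (Z i)}"


subsection \<open>Outputs\<close>

definition uniform_average :: "(nat \<Rightarrow> 'a::real_vector) \<Rightarrow> nat \<Rightarrow> 'a"
  where "uniform_average \<theta> T = (1 / real T) *\<^sub>R (\<Sum>t=1..T. \<theta> t)"

text \<open>The pool after round \<open>t\<close>: the set of the round indices of the maintained iterates, and the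
  weights, which are meaningful only for the indices in that set.\<close>

fun ada_pool ::
    "('m \<Rightarrow> 'a \<Rightarrow> real) \<Rightarrow> (nat \<Rightarrow> 'a) \<Rightarrow> nat \<Rightarrow> nat set \<times> (nat \<Rightarrow> real)"
  where
    "ada_pool f \<theta> 0 = ({}, \<lambda>_. 0)"
  | "ada_pool f \<theta> (Suc n) =
      (let (P, c) = ada_pool f \<theta> n;
           t = Suc n;
           A = {\<tau>\<in>P. dominates f (\<theta> \<tau>) (\<theta> t)};
           B = {\<tau>\<in>P. dominates f (\<theta> t) (\<theta> \<tau>)}
       in if A \<noteq> {}
          then (P, \<lambda>\<tau>. if \<tau> \<in> A then c \<tau> + 1 / real (card A) else c \<tau>)
          else (insert t (P - B), c(t := 1 + (\<Sum>\<tau>\<in>B. c \<tau>))))"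

definition adaptive_average ::
    "('m \<Rightarrow> 'a \<Rightarrow> real) \<Rightarrow> (nat \<Rightarrow> 'a::real_vector) \<Rightarrow> nat \<Rightarrow> 'a"
  where "adaptive_average f \<theta> T =
    (1 / real T) *\<^sub>R (\<Sum>\<tau>\<in>fst (ada_pool f \<theta> T). snd (ada_pool f \<theta> T) \<tau> *\<^sub>R \<theta> \<tau>)"

end

theory Submission
  imports Defs
begin

text \<open>The gap is at most the averaged duality gap
  \<open>1/T \<Sum> (\<langle>\<nabla>\<^sub>\<theta>, \<theta>\<^sub>t - \<theta>*\<rangle> + \<langle>-\<nabla>\<^sub>\<lambda>, \<lambda>\<^sub>t - \<lambda>*\<rangle>)\<close>; for the adaptive output this uses that moving
  weight from a dominated iterate to a dominating one only decreases every objective. The standard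
  mirror descent regret bounds this with \<open>\<nabla>\<close> replaced by the stochastic gradient \<open>g\<close>. The points
  \<open>\<theta>*\<close>, \<open>\<lambda>*\<close> are random, so the error \<open>\<langle>\<nabla> - g, x\<^sub>t - x*\<rangle>\<close> is split along an auxiliary mirror descent
  \<open>u\<^sub>t\<close> driven by \<open>\<nabla> - g\<close>: the part \<open>\<langle>\<nabla> - g, u\<^sub>t - x*\<rangle>\<close> is again a regret, and \<open>\<langle>\<nabla> - g, x\<^sub>t - u\<^sub>t\<rangle>\<close>
  is a bounded martingale difference, to which the Azuma-Hoeffding inequality applies, once for both
  players together.\<close>

section \<open>Norms and their duals\<close>

text \<open>The iterates are given only as minimizers, whereas conditional expectations and the
  final event need them measurable. Strong convexity removes this obstacle: for a fixed step size
  the minimizer is a Lipschitz function of a single vector, the gradient estimate minus the rescaled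
  gradient of the distance-generating function. By induction the iterates of both players are
  therefore determined measurably by the batches of earlier rounds. The same function builds the
  auxiliary sequences, whose minimizers exist because both domains are compact. The regret bounds
  are pathwise and hold for all admissible comparison points outside one null set, so the random
  points \<theta>* and \<lambda>* are inserted separately for each outcome.\<close>

lemma is_norm_le_norm:
  fixes N :: "'a::euclidean_space \<Rightarrow> real"
  assumes "is_norm N"
  shows "N x \<le> norm x * (\<Sum>b\<in>Basis. N b)"
proof -
  have sc: "N (a *\<^sub>R y) = \<bar>a\<bar> * N y" and tri: "N (y + z) \<le> N y + N z" and nn: "0 \<le> N y"
    and N0: "N 0 = 0" for a y z
    using assms by (auto simp: is_norm_def)
  have sum: "N (\<Sum>b\<in>A. h b) \<le> (\<Sum>b\<in>A. N (h b))" if "finite A" for A and h :: "'a \<Rightarrow> 'a"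
    using that by (induction A rule: finite_induct) (auto simp: N0 intro: order_trans[OF tri])
  have "N x = N (\<Sum>b\<in>Basis. (x \<bullet> b) *\<^sub>R b)" by (simp add: euclidean_representation)
  also have "\<dots> \<le> (\<Sum>b\<in>Basis. \<bar>x \<bullet> b\<bar> * N b)" using sum[OF finite_Basis, of "\<lambda>b. (x \<bullet> b) *\<^sub>R b"] by (simp add: sc)
  also have "\<dots> \<le> (\<Sum>b\<in>Basis. norm x * N b)"
    by (intro sum_mono mult_right_mono nn Basis_le_norm)
  finally show ?thesis by (simp add: sum_distrib_left)
qed

lemma is_norm_minus: "is_norm N \<Longrightarrow> N (- x) = N x"
  unfolding is_norm_def by (metis abs_minus_cancel abs_one mult_1 scaleR_minus1_left)

lemma is_norm_minus_commute: "is_norm N \<Longrightarrow> N (x - y) = N (y - x)"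
  using is_norm_minus[of N "x - y"] by simp

lemma is_norm_continuous:
  fixes N :: "'a::euclidean_space \<Rightarrow> real"
  assumes "is_norm N"
  shows "continuous_on A N"
proof -
  define K where "K = (\<Sum>b\<in>Basis. N b)"
  have tri: "N (y + z) \<le> N y + N z" and nn: "0 \<le> N y" for y z
    using assms by (auto simp: is_norm_def)
  have K: "0 \<le> K" unfolding K_def by (intro sum_nonneg nn)
  have d: "N x - N y \<le> K * norm (x - y)" for x y
    using tri[of "x - y" y] is_norm_le_norm[OF assms, of "x - y"] by (simp add: K_def mult.commute)
  have "dist (N x) (N y) \<le> K * dist x y" for x y
    using d[of x y] d[of y x] by (auto simp: dist_norm norm_minus_commute)
  then have "K-lipschitz_on A N" using K by (intro lipschitz_onI) auto
  then show ?thesis by (rule lipschitz_on_continuous_on)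
qed

text \<open>The minimum of \<open>N\<close> over the Euclidean unit sphere is attained, and positive
  by definiteness; homogeneity does the rest. This half of the equivalence of norms keeps dual norms
  finite and turns strong convexity in \<open>N\<close> into Euclidean Lipschitz bounds.\<close>

lemma is_norm_ge_norm:
  fixes N :: "'a::euclidean_space \<Rightarrow> real"
  assumes "is_norm N"
  obtains c where "c > 0" "\<And>x. c * norm x \<le> N x"
proof -
  have ne: "sphere (0::'a) 1 \<noteq> {}" by simp
  obtain x0 where x0: "x0 \<in> sphere 0 1" "\<And>y. y \<in> sphere 0 1 \<Longrightarrow> N x0 \<le> N y"
    using continuous_attains_inf[OF compact_sphere ne is_norm_continuous[OF assms]] by blast
  have "x0 \<noteq> 0" using x0(1) by auto
  then have "N x0 > 0" using assms unfolding is_norm_def by (metis order_le_less)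
  moreover have "N x0 * norm x \<le> N x" for x
  proof (cases "x = 0")
    case False
    have sc: "N (a *\<^sub>R y) = \<bar>a\<bar> * N y" for a y using assms by (auto simp: is_norm_def)
    have "N x0 \<le> N ((1 / norm x) *\<^sub>R x)" using False by (intro x0) auto
    also have "\<dots> = N x / norm x" by (simp add: sc)
    finally show ?thesis using False by (simp add: field_simps)
  qed (use assms in \<open>auto simp: is_norm_def\<close>)
  ultimately show ?thesis using that by blast
qed

text \<open>A real \<open>SUP\<close> says nothing about an unbounded set, so every comparison of a
  functional with its dual norm rests on this.\<close>

lemma dual_norm_bdd_above:
  fixes N :: "'a::euclidean_space \<Rightarrow> real"
  assumes "is_norm N"
  shows "bdd_above ((\<lambda>x. g \<bullet> x) ` {x. N x \<le> 1})"
proof -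
  obtain c where c: "c > 0" "\<And>x. c * norm x \<le> N x" using is_norm_ge_norm[OF assms] by blast
  have "g \<bullet> x \<le> norm g / c" if "N x \<le> 1" for x
  proof -
    have "norm x \<le> 1 / c" using c(2)[of x] that c(1) by (simp add: field_simps)
    then have "norm g * norm x \<le> norm g * (1 / c)" by (intro mult_left_mono) auto
    then show ?thesis using norm_cauchy_schwarz[of g x] by simp
  qed
  then show ?thesis by (auto intro!: bdd_aboveI2)
qed

lemma inner_le_dual_norm:
  fixes N :: "'a::euclidean_space \<Rightarrow> real"
  assumes "is_norm N"
  shows "g \<bullet> x \<le> dual_norm N g * N x"
proof (cases "x = 0")
  case False
  then have N: "N x > 0" using assms unfolding is_norm_def by (metis order_le_less)
  have "N ((1 / N x) *\<^sub>R x) = \<bar>1 / N x\<bar> * N x" using assms by (simp only: is_norm_def)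
  then have "N ((1 / N x) *\<^sub>R x) \<le> 1" using N by simp
  then have "g \<bullet> ((1 / N x) *\<^sub>R x) \<le> dual_norm N g"
    unfolding dual_norm_def by (intro cSUP_upper dual_norm_bdd_above[OF assms]) auto
  then show ?thesis using N by (simp add: field_simps)
next
  case True
  moreover have "N 0 = 0" using assms by (auto simp: is_norm_def)
  ultimately show ?thesis by simp
qed

lemma dual_norm_le:
  assumes "is_norm N" "\<And>x. N x \<le> 1 \<Longrightarrow> g \<bullet> x \<le> B"
  shows "dual_norm N g \<le> B"
proof -
  have "N 0 = 0" using assms(1) by (auto simp: is_norm_def)
  then have "(0::'a) \<in> {x. N x \<le> 1}" by simp
  then show ?thesis unfolding dual_norm_def using assms(2) by (intro cSUP_least) auto
qed

lemma dual_norm_ge: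
  fixes N :: "'a::euclidean_space \<Rightarrow> real"
  assumes "is_norm N" "N x \<le> 1"
  shows "g \<bullet> x \<le> dual_norm N g"
  unfolding dual_norm_def using assms by (intro cSUP_upper dual_norm_bdd_above) auto

lemma dual_norm_nonneg:
  fixes N :: "'a::euclidean_space \<Rightarrow> real"
  assumes "is_norm N"
  shows "0 \<le> dual_norm N g"
proof -
  have "N 0 = 0" using assms by (auto simp: is_norm_def)
  then show ?thesis using dual_norm_ge[OF assms, of 0 g] by simp
qed

lemma dual_norm_minus:
  fixes N :: "'a::euclidean_space \<Rightarrow> real"
  assumes "is_norm N"
  shows "dual_norm N (- g) = dual_norm N g"
proof -
  have "dual_norm N (- h) \<le> dual_norm N h" for h
  proof (rule dual_norm_le[OF assms])
    fix x assume "N x \<le> 1"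
    then show "- h \<bullet> x \<le> dual_norm N h"
      using dual_norm_ge[OF assms, of "- x" h] is_norm_minus[OF assms, of x] by simp
  qed
  from this[of g] this[of "- g"] show ?thesis by simp
qed

lemma dual_norm_triangle:
  fixes N :: "'a::euclidean_space \<Rightarrow> real"
  assumes "is_norm N"
  shows "dual_norm N (g - h) \<le> dual_norm N g + dual_norm N h"
proof (rule dual_norm_le[OF assms])
  fix x assume "N x \<le> 1"
  then show "(g - h) \<bullet> x \<le> dual_norm N g + dual_norm N h"
    using dual_norm_ge[OF assms, of x g] dual_norm_ge[OF assms, of x "- h"]
    by (simp add: inner_diff_left dual_norm_minus[OF assms])
qed


section \<open>Gradients and Bregman divergences\<close>

text \<open>\<open>gradient\<close> is a definite description: existence comes from reading the
  derivative off the basis, uniqueness from that of the derivative.\<close>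

lemma GDERIV_gradient:
  fixes f :: "'a::euclidean_space \<Rightarrow> real"
  assumes "f differentiable (at x)"
  shows "GDERIV f x :> gradient f x"
proof -
  obtain f' where f': "(f has_derivative f') (at x)" using assms by (auto simp: differentiable_def)
  define D where "D = (\<Sum>b\<in>Basis. f' b *\<^sub>R b)"
  have lin: "linear f'" using f' by (simp add: has_derivative_linear)
  have "f' h = h \<bullet> D" for h
  proof -
    have "f' h = f' (\<Sum>b\<in>Basis. (h \<bullet> b) *\<^sub>R b)" by (simp add: euclidean_representation)
    also have "\<dots> = (\<Sum>b\<in>Basis. (h \<bullet> b) * f' b)"
      using lin by (simp add: linear_sum linear_scale)
    also have "\<dots> = h \<bullet> D" by (simp add: D_def inner_sum_right mult.commute)
    finally show ?thesis .
  qed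
  then have D: "GDERIV f x :> D" using f' unfolding gderiv_def by (metis (no_types) ext)
  show ?thesis unfolding gradient_def
  proof (rule theI2[of _ D])
    fix D' assume "GDERIV f x :> D'"
    then have "(\<lambda>h. h \<bullet> D') = (\<lambda>h. h \<bullet> D)"
      using D unfolding gderiv_def by (rule has_derivative_unique)
    then show "D' = D" by (metis vector_eq_ldot)
  qed (use D in auto)
qed

lemma gradient_eqI:
  fixes f :: "'a::euclidean_space \<Rightarrow> real"
  assumes "GDERIV f x :> D"
  shows "gradient f x = D"
proof -
  have "GDERIV f x :> gradient f x"
    using assms by (intro GDERIV_gradient) (auto simp: differentiable_def gderiv_def)
  then have "(\<lambda>h. h \<bullet> gradient f x) = (\<lambda>h. h \<bullet> D)"
    using assms unfolding gderiv_def by (rule has_derivative_unique)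
  then show ?thesis by (metis vector_eq_ldot)
qed

text \<open>The limit is one-sided because, in the uses below, the segment towards another point of
  \<open>X\<close> is known to be feasible only for \<open>a\<close> between 0 and 1.\<close>

lemma GDERIV_directional:
  assumes "GDERIV f x :> D"
  shows "((\<lambda>a. (f (x + a *\<^sub>R v) - f x) / a) \<longlongrightarrow> D \<bullet> v) (at_right (0::real))"
proof -
  have "(f has_derivative (\<lambda>h. h \<bullet> D)) (at (x + 0 *\<^sub>R v))" using assms by (simp add: gderiv_def)
  moreover have "((\<lambda>a. x + a *\<^sub>R v) has_derivative (\<lambda>a. a *\<^sub>R v)) (at (0::real))"
    by (auto intro!: derivative_eq_intros)
  ultimately have "((\<lambda>a. f (x + a *\<^sub>R v)) has_derivative (\<lambda>a. (a *\<^sub>R v) \<bullet> D)) (at (0::real))"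
    by (rule has_derivative_compose[rotated])
  then have "((\<lambda>a. f (x + a *\<^sub>R v)) has_real_derivative (D \<bullet> v)) (at 0)"
    unfolding has_field_derivative_def
    by (rule has_derivative_eq_rhs) (auto simp: inner_commute mult.commute)
  then have "((\<lambda>a. (f (x + a *\<^sub>R v) - f x) / a) \<longlongrightarrow> D \<bullet> v) (at 0)"
    by (simp add: has_field_derivative_iff)
  then show ?thesis by (rule filterlim_at_split[THEN iffD1, THEN conjunct2])
qed

text \<open>Divide strong convexity on the segment from \<open>y\<close> to \<open>x\<close> by its
  parameter \<open>a\<close> and let \<open>a\<close> tend to 0 from above: the factor
  \<open>1 - a\<close> of the quadratic term tends to 1. Differentiability enters at
  \<open>y\<close> only, so comparison points \<open>x\<close> outside \<open>X0\<close> are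
  covered.\<close>

lemma bregman_ge:
  fixes \<psi> :: "'a::euclidean_space \<Rightarrow> real"
  assumes sc: "strongly_convex_on X N \<mu> \<psi>" and xy: "x \<in> X" "y \<in> X"
    and diff: "\<psi> differentiable (at y)"
  shows "\<mu> / 2 * (N (x - y))\<^sup>2 \<le> bregman \<psi> x y"
proof -
  let ?c = "\<mu> / 2 * (N (x - y))\<^sup>2"
  have "gradient \<psi> y \<bullet> (x - y) \<le> \<psi> x - \<psi> y - ?c * (1 - 0)"
  proof (rule tendsto_le)
    show "((\<lambda>a. (\<psi> (y + a *\<^sub>R (x - y)) - \<psi> y) / a) \<longlongrightarrow> gradient \<psi> y \<bullet> (x - y)) (at_right 0)"
      by (rule GDERIV_directional[OF GDERIV_gradient[OF diff]])
    show "((\<lambda>a. \<psi> x - \<psi> y - ?c * (1 - a)) \<longlongrightarrow> \<psi> x - \<psi> y - ?c * (1 - 0)) (at_right 0)"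
      by (intro tendsto_intros)
    show "\<forall>\<^sub>F a in at_right 0. (\<psi> (y + a *\<^sub>R (x - y)) - \<psi> y) / a \<le> \<psi> x - \<psi> y - ?c * (1 - a)"
      unfolding eventually_at_right_field
    proof (intro exI[of _ 1] conjI allI impI)
      fix a :: real assume a: "0 < a" "a < 1"
      have "y + a *\<^sub>R (x - y) = a *\<^sub>R x + (1 - a) *\<^sub>R y" by (simp add: algebra_simps)
      then have "\<psi> (y + a *\<^sub>R (x - y)) \<le> a * \<psi> x + (1 - a) * \<psi> y - \<mu> / 2 * a * (1 - a) * (N (x - y))\<^sup>2"
        using sc xy a by (auto simp: strongly_convex_on_def)
      also have "\<dots> = \<psi> y + a * (\<psi> x - \<psi> y - ?c * (1 - a))" by (simp add: algebra_simps)
      finally have "\<psi> (y + a *\<^sub>R (x - y)) - \<psi> y \<le> (\<psi> x - \<psi> y - ?c * (1 - a)) * a"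
        by (simp add: mult.commute)
      then show "(\<psi> (y + a *\<^sub>R (x - y)) - \<psi> y) / a \<le> \<psi> x - \<psi> y - ?c * (1 - a)"
        using a by (simp only: pos_divide_le_eq)
    qed auto
  qed auto
  then show ?thesis by (simp add: bregman_def)
qed

text \<open>Convexity is strong convexity of modulus 0, whatever the norm, so this is the case
  \<open>\<mu> = 0\<close> of the Bregman bound.\<close>

lemma convex_on_gradient_le:
  fixes f :: "'a::euclidean_space \<Rightarrow> real"
  assumes "convex_on X f" "x \<in> X" "y \<in> X" "f differentiable (at y)"
  shows "gradient f y \<bullet> (x - y) \<le> f x - f y"
proof -
  have "strongly_convex_on X N 0 f" for N
    unfolding strongly_convex_on_def using assms(1) by (auto simp: convex_on_alt)
  from bregman_ge[OF this assms(2,3,4)] show ?thesis by (simp add: bregman_def)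
qed

lemma arg_min_first_order:
  fixes f :: "'a::euclidean_space \<Rightarrow> real"
  assumes "is_arg_min f (\<lambda>x. x \<in> X) x" "convex X" "z \<in> X" "GDERIV f x :> D"
  shows "0 \<le> D \<bullet> (z - x)"
proof (rule tendsto_le)
  show "((\<lambda>a. (f (x + a *\<^sub>R (z - x)) - f x) / a) \<longlongrightarrow> D \<bullet> (z - x)) (at_right 0)"
    by (rule GDERIV_directional[OF assms(4)])
  show "\<forall>\<^sub>F a in at_right 0. 0 \<le> (f (x + a *\<^sub>R (z - x)) - f x) / a"
    unfolding eventually_at_right_field
  proof (intro exI[of _ 1] conjI allI impI)
    fix a :: real assume a: "0 < a" "a < 1"
    have "x \<in> X" using assms(1) by (simp add: is_arg_min_def)
    then have "x + a *\<^sub>R (z - x) \<in> X"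
      using convexD_alt[OF assms(2) _ assms(3), of x a] a by (simp add: algebra_simps)
    then have "f x \<le> f (x + a *\<^sub>R (z - x))" using assms(1) by (auto simp: is_arg_min_linorder)
    then show "0 \<le> (f (x + a *\<^sub>R (z - x)) - f x) / a" using a by simp
  qed auto
qed auto

lemma distance_generatingD:
  fixes \<psi> :: "'a::euclidean_space \<Rightarrow> real"
  assumes "distance_generating X X0 \<psi>"
  shows "X0 \<subseteq> X" "continuous_on X \<psi>" "\<And>x. x \<in> X0 \<Longrightarrow> \<psi> differentiable (at x)"
    "continuous_on X0 (gradient \<psi>)"
  using assms unfolding distance_generating_def by (blast intro: continuous_on_subset)+


section \<open>Regret of online mirror descent\<close>

text \<open>Optimality of \<open>x\<close> tested against \<open>z\<close>, together with the
  three-point identity, leaves a term \<open>- bregman \<psi> x y\<close>. Strong convexity turns it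
  into a negative quadratic in \<open>N (y - x)\<close>, which pays for passing from
  \<open>g \<bullet> (x - z)\<close> to \<open>g \<bullet> (y - z)\<close>.\<close>

lemma omd_step:
  fixes \<psi> :: "'a::euclidean_space \<Rightarrow> real"
  assumes X: "convex X" and \<psi>: "distance_generating X X0 \<psi>" "prox_closed X X0 \<psi>"
    "strongly_convex_on X N \<mu> \<psi>" and N: "is_norm N" and pos: "\<mu> > 0" "\<eta> > 0"
    and y: "y \<in> X0" and z: "z \<in> X"
    and step: "is_arg_min (\<lambda>x. g \<bullet> x + 1 / \<eta> * bregman \<psi> x y) (\<lambda>x. x \<in> X) x"
  shows "g \<bullet> (y - z) \<le> (bregman \<psi> z y - bregman \<psi> z x) / \<eta> + \<eta> / (2 * \<mu>) * (dual_norm N g)\<^sup>2"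
proof -
  have x: "x \<in> X0" using \<psi>(2) y step pos by (auto simp: prox_closed_def)
  have xX: "x \<in> X" "y \<in> X" using x y distance_generatingD(1)[OF \<psi>(1)] by auto
  let ?D = "g + (1 / \<eta>) *\<^sub>R (gradient \<psi> x - gradient \<psi> y)"
  have "(\<psi> has_derivative (\<lambda>h. h \<bullet> gradient \<psi> x)) (at x)"
    using GDERIV_gradient[OF distance_generatingD(3)[OF \<psi>(1) x]] by (simp add: gderiv_def)
  then have "((\<lambda>x. g \<bullet> x + 1 / \<eta> * bregman \<psi> x y) has_derivative
      (\<lambda>h. g \<bullet> h + 1 / \<eta> * (h \<bullet> gradient \<psi> x - gradient \<psi> y \<bullet> h))) (at x)"
    unfolding bregman_def
    by (intro has_derivative_add has_derivative_inner_right has_derivative_ident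
        has_derivative_mult_right has_derivative_diff[THEN has_derivative_eq_rhs]) (auto intro!: derivative_eq_intros)
  then have "GDERIV (\<lambda>x. g \<bullet> x + 1 / \<eta> * bregman \<psi> x y) x :> ?D"
    unfolding gderiv_def
    by (rule has_derivative_eq_rhs) (simp add: fun_eq_iff inner_commute inner_add_right inner_diff_right)
  from arg_min_first_order[OF step X z this]
  have "0 \<le> \<eta> * (?D \<bullet> (z - x))" using pos by simp
  also have "\<dots> = \<eta> * (g \<bullet> (z - x)) + (gradient \<psi> x - gradient \<psi> y) \<bullet> (z - x)"
    using pos by (simp add: inner_add_left inner_diff_left distrib_left right_diff_distrib)
  also have "(gradient \<psi> x - gradient \<psi> y) \<bullet> (z - x)
      = bregman \<psi> z y - bregman \<psi> z x - bregman \<psi> x y"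
    by (simp add: bregman_def inner_diff_left inner_diff_right algebra_simps)
  finally have 1: "\<eta> * (g \<bullet> (x - z)) \<le> bregman \<psi> z y - bregman \<psi> z x - bregman \<psi> x y"
    by (simp add: inner_diff_right algebra_simps)
  have 2: "\<mu> / 2 * (N (y - x))\<^sup>2 \<le> bregman \<psi> x y"
    using bregman_ge[OF \<psi>(3) xX distance_generatingD(3)[OF \<psi>(1) y]]
    by (simp add: is_norm_minus_commute[OF N])
  let ?d = "dual_norm N g"
  have "\<eta> * (g \<bullet> (y - x)) \<le> \<eta> * (?d * N (y - x))"
    using inner_le_dual_norm[OF N, of g "y - x"] pos by simp
  \<comment> \<open>Young's inequality, weighted so that its quadratic part is exactly the lower
    bound for \<open>bregman \<psi> x y\<close>.\<close>
  also have "\<dots> \<le> \<mu> / 2 * (N (y - x))\<^sup>2 + \<eta>\<^sup>2 / (2 * \<mu>) * ?d\<^sup>2"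
  proof -
    have "0 \<le> (\<mu> * N (y - x) - \<eta> * ?d)\<^sup>2 / (2 * \<mu>)" using pos by simp
    then show ?thesis using pos by (simp add: power2_eq_square field_simps)
  qed
  finally have "\<eta> * (g \<bullet> (y - z)) \<le> bregman \<psi> z y - bregman \<psi> z x + \<eta>\<^sup>2 / (2 * \<mu>) * ?d\<^sup>2"
    using 1 2 by (simp add: inner_diff_right algebra_simps)
  then have "g \<bullet> (y - z) \<le> (bregman \<psi> z y - bregman \<psi> z x + \<eta>\<^sup>2 / (2 * \<mu>) * ?d\<^sup>2) / \<eta>"
    using pos by (simp add: pos_le_divide_eq mult.commute)
  also have "\<dots> = (bregman \<psi> z y - bregman \<psi> z x) / \<eta> + \<eta> / (2 * \<mu>) * ?d\<^sup>2"
    using pos by (simp add: power2_eq_square add_divide_distrib)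
  finally show ?thesis .
qed

lemma omd_iterates_in:
  assumes "prox_closed X X0 \<psi>" "\<eta> > 0" "x 0 \<in> X0"
    and "\<And>n. n < T \<Longrightarrow>
      is_arg_min (\<lambda>y. g n \<bullet> y + 1 / \<eta> * bregman \<psi> y (x n)) (\<lambda>y. y \<in> X) (x (Suc n))"
    and "n \<le> T"
  shows "x n \<in> X0"
  using assms(5)
proof (induction n)
  case (Suc n)
  then show ?case using assms(1,2) assms(4)[of n] unfolding prox_closed_def by (metis Suc_leD Suc_le_lessD)
qed (rule assms)

text \<open>The one-step bounds telescope, and the divergence from the last iterate is nonnegative
  by strong convexity and is dropped. The argument is pathwise, so \<open>z\<close> may later depend
  on the outcome.\<close>

lemma omd_regret:
  fixes \<psi> :: "'a::euclidean_space \<Rightarrow> real"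
  assumes X: "convex X" and \<psi>: "distance_generating X X0 \<psi>" "prox_closed X X0 \<psi>"
    "strongly_convex_on X N \<mu> \<psi>" and N: "is_norm N" and pos: "\<mu> > 0" "\<eta> > 0"
    and x0: "x 0 \<in> X0" and z: "z \<in> X"
    and step: "\<And>n. n < T \<Longrightarrow>
      is_arg_min (\<lambda>y. g n \<bullet> y + 1 / \<eta> * bregman \<psi> y (x n)) (\<lambda>y. y \<in> X) (x (Suc n))"
    and B: "\<And>n. n < T \<Longrightarrow> (dual_norm N (g n))\<^sup>2 \<le> B"
  shows "(\<Sum>n<T. g n \<bullet> (x n - z)) \<le> bregman \<psi> z (x 0) / \<eta> + real T * (\<eta> / (2 * \<mu>) * B)"
proof -
  have xin: "x n \<in> X0" if "n \<le> T" for n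
    using omd_iterates_in[where x = x, OF \<psi>(2) pos(2) x0 step] that by blast
  have "(\<Sum>n<k. g n \<bullet> (x n - z))
      \<le> (bregman \<psi> z (x 0) - bregman \<psi> z (x k)) / \<eta> + real k * (\<eta> / (2 * \<mu>) * B)" if "k \<le> T" for k
    using that
  proof (induction k)
    case (Suc k)
    have "g k \<bullet> (x k - z) \<le> (bregman \<psi> z (x k) - bregman \<psi> z (x (Suc k))) / \<eta>
        + \<eta> / (2 * \<mu>) * (dual_norm N (g k))\<^sup>2"
      using Suc.prems by (intro omd_step[OF X \<psi> N pos xin z step]) auto
    moreover have "\<eta> / (2 * \<mu>) * (dual_norm N (g k))\<^sup>2 \<le> \<eta> / (2 * \<mu>) * B"
      using Suc.prems pos by (intro mult_left_mono B) auto
    ultimately show ?case using Suc by (simp add: diff_divide_distrib add_divide_distrib distrib_right)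
  qed simp
  from this[of T] have "(\<Sum>n<T. g n \<bullet> (x n - z))
      \<le> (bregman \<psi> z (x 0) - bregman \<psi> z (x T)) / \<eta> + real T * (\<eta> / (2 * \<mu>) * B)" by simp
  moreover have "0 \<le> bregman \<psi> z (x T)"
  proof -
    have "x T \<in> X" using xin distance_generatingD(1)[OF \<psi>(1)] by auto
    then have "\<mu> / 2 * (N (z - x T))\<^sup>2 \<le> bregman \<psi> z (x T)"
      using xin by (intro bregman_ge[OF \<psi>(3) z] distance_generatingD(3)[OF \<psi>(1)]) auto
    moreover have "0 \<le> \<mu> / 2 * (N (z - x T))\<^sup>2" using pos by simp
    ultimately show ?thesis by linarith
  qed
  ultimately show ?thesis using pos by (simp add: diff_divide_distrib)
      (smt (verit) divide_nonneg_pos)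
qed

text \<open>The comparison point may depend on the noise of all rounds, so \<open>\<Sum> (G n - g n) \<bullet> (x n - z)\<close> is
  no martingale. The auxiliary sequence \<open>u\<close> runs mirror descent on the noise itself, and its own
  regret bound replaces \<open>z\<close> by the predictable \<open>u n\<close>.\<close>

lemma omd_ghost_regret:
  fixes \<psi> :: "'a::euclidean_space \<Rightarrow> real"
  assumes X: "convex X" and \<psi>: "distance_generating X X0 \<psi>" "prox_closed X X0 \<psi>"
    "strongly_convex_on X N \<mu> \<psi>" and N: "is_norm N" and pos: "\<mu> > 0" "\<eta> > 0"
    and x0: "x 0 \<in> X0" and u0: "u 0 = x 0" and z: "z \<in> X"
    and step: "\<And>n. n < T \<Longrightarrow>
      is_arg_min (\<lambda>y. g n \<bullet> y + 1 / \<eta> * bregman \<psi> y (x n)) (\<lambda>y. y \<in> X) (x (Suc n))"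
    and ghost: "\<And>n. n < T \<Longrightarrow>
      is_arg_min (\<lambda>y. (G n - g n) \<bullet> y + 1 / \<eta> * bregman \<psi> y (u n)) (\<lambda>y. y \<in> X) (u (Suc n))"
    and B: "\<And>n. n < T \<Longrightarrow> (dual_norm N (g n))\<^sup>2 \<le> B" "\<And>n. n < T \<Longrightarrow> (dual_norm N (G n))\<^sup>2 \<le> B"
  shows "(\<Sum>n<T. G n \<bullet> (x n - z)) \<le> 2 * bregman \<psi> z (x 0) / \<eta> + real T * (5 * \<eta> / (2 * \<mu>) * B)
    + (\<Sum>n<T. (G n - g n) \<bullet> (x n - u n))"
proof -
  \<comment> \<open>The noise is a difference of two vectors of squared dual norm at most
    \<open>B\<close>, and \<open>(a + b)\<^sup>2 \<le> 2 * a\<^sup>2 + 2 * b\<^sup>2\<close>. The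
    auxiliary descent costs 4 units against 1 for the actual one, which is the origin of the 5 in
    the step sizes.\<close>
  have B': "(dual_norm N (G n - g n))\<^sup>2 \<le> 4 * B" if "n < T" for n
  proof -
    let ?a = "dual_norm N (G n)" and ?b = "dual_norm N (g n)"
    have "(dual_norm N (G n - g n))\<^sup>2 \<le> (?a + ?b)\<^sup>2"
      by (intro power_mono dual_norm_triangle dual_norm_nonneg N)
    also have "\<dots> \<le> 2 * ?a\<^sup>2 + 2 * ?b\<^sup>2"
      using zero_le_power2[of "?a - ?b"] by (simp add: power2_sum power2_diff)
    finally show ?thesis using B that by fastforce
  qed
  have "(\<Sum>n<T. (G n - g n) \<bullet> (u n - z)) \<le> bregman \<psi> z (u 0) / \<eta> + real T * (\<eta> / (2 * \<mu>) * (4 * B))"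
    using x0 u0 by (intro omd_regret[where x = u, OF X \<psi> N pos _ z ghost B']) auto
  moreover have "(\<Sum>n<T. g n \<bullet> (x n - z)) \<le> bregman \<psi> z (x 0) / \<eta> + real T * (\<eta> / (2 * \<mu>) * B)"
    by (intro omd_regret[where x = x, OF X \<psi> N pos x0 z step B(1)])
  moreover have "(\<Sum>n<T. G n \<bullet> (x n - z)) = (\<Sum>n<T. g n \<bullet> (x n - z))
      + (\<Sum>n<T. (G n - g n) \<bullet> (u n - z)) + (\<Sum>n<T. (G n - g n) \<bullet> (x n - u n))"
    by (simp add: sum.distrib[symmetric] inner_diff_left inner_diff_right)
  ultimately show ?thesis using u0 by (simp add: field_simps)
qed

text \<open>This \<eta> makes the two summands equal, so their sum is \<open>4 * D / \<eta>\<close>;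
  its value follows by comparing squares. In the application \<open>C\<close> is a dual norm
  constant times the square of \<open>L\<close> or \<open>U\<close>.\<close>

lemma omd_step_size:
  fixes \<mu> D C :: real
  assumes "\<mu> > 0" "D > 0" "C > 0" "T \<ge> 1" and \<eta>: "\<eta> = sqrt (4 * \<mu> * D / (5 * real T * C))"
  shows "2 * D / \<eta> + real T * (5 * \<eta> / (2 * \<mu>) * C) = real T * sqrt (20 * D * C / (\<mu> * real T))"
proof (rule power2_eq_imp_eq)
  have T: "real T > 0" using assms by simp
  have pos: "\<eta> > 0" using assms T by simp
  have sq: "\<eta>\<^sup>2 = 4 * \<mu> * D / (5 * real T * C)" using assms T by simp
  have "real T * (5 * \<eta> / (2 * \<mu>) * C) = (5 * real T * C / (2 * \<mu>)) * \<eta>\<^sup>2 / \<eta>"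
    using pos by (simp add: power2_eq_square)
  also have "\<dots> = 2 * D / \<eta>" unfolding sq using assms T by (simp add: field_simps)
  finally have "(2 * D / \<eta> + real T * (5 * \<eta> / (2 * \<mu>) * C))\<^sup>2 = (4 * D)\<^sup>2 / \<eta>\<^sup>2"
    by (simp add: power_divide)
  also have "\<dots> = (real T * sqrt (20 * D * C / (\<mu> * real T)))\<^sup>2"
    unfolding sq using assms T by (simp add: power_mult_distrib power2_eq_square field_simps)
  finally show "(2 * D / \<eta> + real T * (5 * \<eta> / (2 * \<mu>) * C))\<^sup>2
    = (real T * sqrt (20 * D * C / (\<mu> * real T)))\<^sup>2" .
  show "0 \<le> 2 * D / \<eta> + real T * (5 * \<eta> / (2 * \<mu>) * C)" using pos assms by simp
  show "0 \<le> real T * sqrt (20 * D * C / (\<mu> * real T))" using assms by simp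
qed


section \<open>Measurability of the iterates\<close>

text \<open>Up to a constant the Bregman objective is a linear form plus
  \<open>\<psi> / \<eta>\<close>, so all steps are values of one map at
  \<open>h = g - (1 / \<eta>) *\<^sub>R gradient \<psi> y\<close>. The choice operator serves until
  strong convexity shows uniqueness.\<close>

definition prox :: "'a::real_inner set \<Rightarrow> ('a \<Rightarrow> real) \<Rightarrow> real \<Rightarrow> 'a \<Rightarrow> 'a"
  where "prox X \<psi> \<eta> h = (SOME x. is_arg_min (\<lambda>x. h \<bullet> x + 1 / \<eta> * \<psi> x) (\<lambda>x. x \<in> X) x)"

lemma is_arg_min_prox:
  fixes \<psi> :: "'a::euclidean_space \<Rightarrow> real"
  assumes "compact X" "X \<noteq> {}" "continuous_on X \<psi>"
  shows "is_arg_min (\<lambda>x. h \<bullet> x + 1 / \<eta> * \<psi> x) (\<lambda>x. x \<in> X) (prox X \<psi> \<eta> h)"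
proof -
  have "continuous_on X (\<lambda>x. h \<bullet> x + 1 / \<eta> * \<psi> x)" using assms(3) by (intro continuous_intros)
  from continuous_attains_inf[OF assms(1,2) this]
  have "\<exists>x. is_arg_min (\<lambda>x. h \<bullet> x + 1 / \<eta> * \<psi> x) (\<lambda>x. x \<in> X) x"
    by (auto simp: is_arg_min_linorder)
  then show ?thesis unfolding prox_def by (rule someI_ex)
qed

text \<open>Compare the minimal value with the value at the midpoint of \<open>x\<close> and
  \<open>y\<close>. This yields quadratic growth with half of the best constant, without any
  derivative of \<psi>.\<close>

lemma strongly_convex_arg_min:
  assumes X: "convex X" and sc: "strongly_convex_on X N \<mu> \<psi>" and \<eta>: "\<eta> > 0"
    and x: "is_arg_min (\<lambda>x. h \<bullet> x + 1 / \<eta> * \<psi> x) (\<lambda>x. x \<in> X) x" and y: "y \<in> X"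
  shows "\<mu> / (4 * \<eta>) * (N (x - y))\<^sup>2 \<le> (h \<bullet> y + 1 / \<eta> * \<psi> y) - (h \<bullet> x + 1 / \<eta> * \<psi> x)"
proof -
  let ?m = "(1 / 2) *\<^sub>R x + (1 - 1 / 2) *\<^sub>R y"
  have xX: "x \<in> X" using x by (simp add: is_arg_min_def)
  have "?m \<in> X" using X xX y by (intro convexD) auto
  then have "h \<bullet> x + 1 / \<eta> * \<psi> x \<le> h \<bullet> ?m + 1 / \<eta> * \<psi> ?m"
    using x by (auto simp: is_arg_min_linorder)
  moreover have "\<psi> ?m \<le> 1 / 2 * \<psi> x + (1 - 1 / 2) * \<psi> y - \<mu> / 2 * (1 / 2) * (1 - 1 / 2) * (N (x - y))\<^sup>2"
    using sc[unfolded strongly_convex_on_def, rule_format, OF xX y, of "1/2"] by simp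
  then have "1 / \<eta> * \<psi> ?m \<le> 1 / \<eta> * (1 / 2 * \<psi> x + (1 - 1 / 2) * \<psi> y - \<mu> / 2 * (1 / 2) * (1 - 1 / 2) * (N (x - y))\<^sup>2)"
    using \<eta> by (intro mult_left_mono) auto
  ultimately have "h \<bullet> x + 1 / \<eta> * \<psi> x \<le> h \<bullet> ?m
      + 1 / \<eta> * (1 / 2 * \<psi> x + (1 - 1 / 2) * \<psi> y - \<mu> / 2 * (1 / 2) * (1 - 1 / 2) * (N (x - y))\<^sup>2)"
    by linarith
  also have "\<dots> = (h \<bullet> x + 1 / \<eta> * \<psi> x) / 2 + (h \<bullet> y + 1 / \<eta> * \<psi> y) / 2
      - \<mu> / (4 * \<eta>) * (N (x - y))\<^sup>2 / 2"
    by (simp add: inner_add_right add_divide_distrib diff_divide_distrib distrib_left right_diff_distrib)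
  finally show ?thesis by argo
qed

text \<open>Add the quadratic growth at \<open>x\<close> and at \<open>y\<close>: the values of
  \<psi> cancel. For \<open>h = k\<close> and positive \<mu> it says that the minimizer is
  unique.\<close>

lemma arg_min_stable:
  assumes X: "convex X" and sc: "strongly_convex_on X N \<mu> \<psi>" and N: "is_norm N" and \<eta>: "\<eta> > 0"
    and x: "is_arg_min (\<lambda>x. h \<bullet> x + 1 / \<eta> * \<psi> x) (\<lambda>x. x \<in> X) x"
    and y: "is_arg_min (\<lambda>x. k \<bullet> x + 1 / \<eta> * \<psi> x) (\<lambda>x. x \<in> X) y"
  shows "\<mu> / (2 * \<eta>) * (N (x - y))\<^sup>2 \<le> (h - k) \<bullet> (y - x)"
proof -
  have "x \<in> X" "y \<in> X" using x y by (auto simp: is_arg_min_def)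
  from strongly_convex_arg_min[OF X sc \<eta> x this(2)] strongly_convex_arg_min[OF X sc \<eta> y this(1)]
  show ?thesis by (simp add: is_norm_minus_commute[OF N, of y x] inner_diff_left inner_diff_right field_simps)
qed

text \<open>Cauchy-Schwarz on the right of the stability estimate,
  \<open>c * norm x \<le> N x\<close> on its left. Being continuous, \<open>prox\<close> is Borel,
  which takes the place of a measurable selection of minimizers.\<close>

lemma prox_lipschitz:
  fixes \<psi> :: "'a::euclidean_space \<Rightarrow> real"
  assumes X: "convex X" "compact X" "X \<noteq> {}" "continuous_on X \<psi>"
    and sc: "strongly_convex_on X N \<mu> \<psi>" and N: "is_norm N" and pos: "\<mu> > 0" "\<eta> > 0"
  obtains K where "K-lipschitz_on UNIV (prox X \<psi> \<eta>)"
proof -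
  obtain c where c: "c > 0" "\<And>x. c * norm x \<le> N x" using is_norm_ge_norm[OF N] by blast
  let ?K = "2 * \<eta> / (\<mu> * c\<^sup>2)"
  have "norm (prox X \<psi> \<eta> h - prox X \<psi> \<eta> k) \<le> ?K * norm (h - k)" for h k
  proof (cases "prox X \<psi> \<eta> h = prox X \<psi> \<eta> k")
    case False
    let ?d = "prox X \<psi> \<eta> h - prox X \<psi> \<eta> k"
    have "\<mu> / (2 * \<eta>) * (c * norm ?d)\<^sup>2 \<le> \<mu> / (2 * \<eta>) * (N ?d)\<^sup>2"
      using c pos by (intro mult_left_mono power_mono) auto
    also have "\<dots> \<le> (h - k) \<bullet> (- ?d)"
      using arg_min_stable[OF X(1) sc N pos(2) is_arg_min_prox[OF X(2-4)] is_arg_min_prox[OF X(2-4)]]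
      by simp
    also have "\<dots> \<le> norm (h - k) * norm ?d" using norm_cauchy_schwarz[of "h - k" "- ?d"] by (simp only: norm_minus_cancel)
    finally have "(\<mu> * c\<^sup>2 / (2 * \<eta>) * norm ?d) * norm ?d \<le> norm (h - k) * norm ?d"
      by (simp add: power2_eq_square mult.assoc mult.left_commute)
    then have "\<mu> * c\<^sup>2 / (2 * \<eta>) * norm ?d \<le> norm (h - k)"
      by (rule mult_right_le_imp_le) (use False in simp)
    then show ?thesis using c pos by (simp add: field_simps)
  qed (use pos c in auto)
  then have "?K-lipschitz_on UNIV (prox X \<psi> \<eta>)"
    using pos c by (intro lipschitz_onI) (auto simp: dist_norm)
  then show ?thesis using that by blast
qed

lemma is_arg_min_bregman_iff:
  "is_arg_min (\<lambda>x. g \<bullet> x + 1 / \<eta> * bregman \<psi> x y) P x \<longleftrightarrow>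
   is_arg_min (\<lambda>x. (g - (1 / \<eta>) *\<^sub>R gradient \<psi> y) \<bullet> x + 1 / \<eta> * \<psi> x) P x"
  (is "is_arg_min ?f P x \<longleftrightarrow> is_arg_min ?h P x")
proof -
  have "?f = (\<lambda>x. ?h x + 1 / \<eta> * (gradient \<psi> y \<bullet> y - \<psi> y))"
    by (auto simp: bregman_def inner_diff_left inner_diff_right diff_divide_distrib add_divide_distrib)
  then show ?thesis by (simp add: is_arg_min_linorder)
qed

lemma omd_step_eq_prox:
  fixes \<psi> :: "'a::euclidean_space \<Rightarrow> real"
  assumes X: "convex X" "compact X" "continuous_on X \<psi>"
    and sc: "strongly_convex_on X N \<mu> \<psi>" and N: "is_norm N" and pos: "\<mu> > 0" "\<eta> > 0"
    and step: "is_arg_min (\<lambda>x. g \<bullet> x + 1 / \<eta> * bregman \<psi> x y) (\<lambda>x. x \<in> X) x"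
  shows "x = prox X \<psi> \<eta> (g - (1 / \<eta>) *\<^sub>R gradient \<psi> y)"
proof -
  let ?h = "g - (1 / \<eta>) *\<^sub>R gradient \<psi> y"
  have "X \<noteq> {}" using step by (auto simp: is_arg_min_def)
  from arg_min_stable[OF X(1) sc N pos(2) step[unfolded is_arg_min_bregman_iff]
      is_arg_min_prox[OF X(2) this X(3), of ?h \<eta>]]
  have "\<mu> / (2 * \<eta>) * (N (x - prox X \<psi> \<eta> ?h))\<^sup>2 \<le> 0" by simp
  moreover have "\<mu> / (2 * \<eta>) > 0" using pos by simp
  ultimately have "(N (x - prox X \<psi> \<eta> ?h))\<^sup>2 \<le> 0" by (simp only: mult_le_0_iff) linarith
  then have "N (x - prox X \<psi> \<eta> ?h) = 0" by simp
  then show ?thesis using N by (simp add: is_norm_def)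
qed

text \<open>For functions whose continuity is known only where the iterates live: the gradient of
  \<psi> on \<open>X0\<close>, the objectives on \<Theta>.\<close>

lemma borel_measurable_compose_continuous_on:
  assumes "continuous_on A f" "x \<in> borel_measurable F" "\<And>\<omega>. \<omega> \<in> space F \<Longrightarrow> x \<omega> \<in> A"
  shows "(\<lambda>\<omega>. f (x \<omega>)) \<in> borel_measurable F"
proof -
  have "x \<in> measurable F (restrict_space borel A)"
    using assms(2,3) by (intro measurable_restrict_space2) auto
  then show ?thesis
    by (rule measurable_compose) (rule borel_measurable_continuous_on_restrict[OF assms(1)])
qed

text \<open>By uniqueness each iterate is the continuous map \<open>prox\<close> applied to the data
  of the previous step. \<open>x n\<close> depends on the noise of the first \<open>n\<close> steps,
  and \<open>g n\<close> is revealed one step later. The induction is strong because measurability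
  of \<open>g n\<close> may draw on that of all iterates so far.\<close>

lemma omd_measurable:
  fixes \<psi> :: "'a::euclidean_space \<Rightarrow> real"
  assumes X: "convex X" "compact X" and \<psi>: "distance_generating X X0 \<psi>" "prox_closed X X0 \<psi>"
    "strongly_convex_on X N \<mu> \<psi>" and N: "is_norm N" and pos: "\<mu> > 0" "\<eta> > 0"
    and x0: "x0 \<in> X0" "\<And>\<omega>. \<omega> \<in> \<Omega> \<Longrightarrow> x 0 \<omega> = x0"
    and step: "\<And>n \<omega>. n < T \<Longrightarrow> \<omega> \<in> \<Omega> \<Longrightarrow>
      is_arg_min (\<lambda>y. g n \<omega> \<bullet> y + 1 / \<eta> * bregman \<psi> y (x n \<omega>)) (\<lambda>y. y \<in> X) (x (Suc n) \<omega>)"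
    and F: "\<And>n. n \<le> T \<Longrightarrow> space (F n) = \<Omega>" "\<And>n. n < T \<Longrightarrow> subalgebra (F (Suc n)) (F n)"
    and g: "\<And>n. n < T \<Longrightarrow> (\<And>k. k \<le> n \<Longrightarrow> x k \<in> borel_measurable (F k)) \<Longrightarrow>
      g n \<in> borel_measurable (F (Suc n))"
    and n: "n \<le> T"
  shows "x n \<in> borel_measurable (F n)"
  using n
proof (induction n rule: less_induct)
  case (less n)
  show ?case
  proof (cases n)
    case 0
    have "x 0 \<in> borel_measurable (F 0) \<longleftrightarrow> (\<lambda>_. x0) \<in> borel_measurable (F 0)"
      by (rule measurable_cong) (simp add: x0(2) F(1))
    then show ?thesis using 0 by simp
  next
    case (Suc k)
    then have k: "k < T" using less.prems by simp
    have xin: "x k \<omega> \<in> X0" if "\<omega> \<in> \<Omega>" for \<omega>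
    proof (rule omd_iterates_in[where x = "\<lambda>n. x n \<omega>" and g = "\<lambda>n. g n \<omega>", OF \<psi>(2) pos(2)])
      show "x 0 \<omega> \<in> X0" using x0 that by simp
      show "k \<le> T" using k by simp
    qed (rule step[OF _ that])
    have [measurable]: "x k \<in> borel_measurable (F (Suc k))"
      using less.IH[of k] Suc k F(2)[OF k] by (auto intro: measurable_from_subalg)
    have [measurable]: "(\<lambda>\<omega>. gradient \<psi> (x k \<omega>)) \<in> borel_measurable (F (Suc k))"
      using F(1)[of "Suc k"] k xin
      by (intro borel_measurable_compose_continuous_on[OF distance_generatingD(4)[OF \<psi>(1)]]) auto
    have [measurable]: "g k \<in> borel_measurable (F (Suc k))"
      using less.IH Suc k by (intro g) auto
    have ne: "X \<noteq> {}" using x0(1) distance_generatingD(1)[OF \<psi>(1)] by auto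
    obtain K where "K-lipschitz_on UNIV (prox X \<psi> \<eta>)"
      using prox_lipschitz[OF X ne distance_generatingD(2)[OF \<psi>(1)] \<psi>(3) N pos] by blast
    then have [measurable]: "prox X \<psi> \<eta> \<in> borel_measurable borel"
      by (intro borel_measurable_continuous_onI lipschitz_on_continuous_on)
    have "x n \<omega> = prox X \<psi> \<eta> (g k \<omega> - (1 / \<eta>) *\<^sub>R gradient \<psi> (x k \<omega>))" if "\<omega> \<in> space (F n)" for \<omega>
      unfolding Suc
    proof (rule omd_step_eq_prox[OF X distance_generatingD(2)[OF \<psi>(1)] \<psi>(3) N pos step[OF k]])
      show "\<omega> \<in> \<Omega>" using that F(1)[OF less.prems] by simp
    qed
    then have "x n \<in> borel_measurable (F n) \<longleftrightarrow>
        (\<lambda>\<omega>. prox X \<psi> \<eta> (g k \<omega> - (1 / \<eta>) *\<^sub>R gradient \<psi> (x k \<omega>))) \<in> borel_measurable (F n)"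
      by (rule measurable_cong)
    also have "\<dots>" unfolding Suc by measurable
    finally show ?thesis .
  qed
qed

text \<open>The actual iterates are given, but the auxiliary sequence has to be constructed;
  \<open>prox\<close> supplies its minimizers for each outcome.\<close>

primrec omd_iterate ::
    "'a::real_inner set \<Rightarrow> ('a \<Rightarrow> real) \<Rightarrow> real \<Rightarrow> 'a \<Rightarrow> (nat \<Rightarrow> 'a) \<Rightarrow> nat \<Rightarrow> 'a"
  where
    "omd_iterate X \<psi> \<eta> x0 g 0 = x0"
  | "omd_iterate X \<psi> \<eta> x0 g (Suc n) =
      prox X \<psi> \<eta> (g n - (1 / \<eta>) *\<^sub>R gradient \<psi> (omd_iterate X \<psi> \<eta> x0 g n))"

text \<open>\<open>u\<close> is chosen before \<open>z\<close>, and the quantifier over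
  \<open>z\<close> stands inside the almost-everywhere statement, so a comparison point depending on
  the outcome may be inserted. That \<open>u n\<close> is \<open>F n\<close>-measurable is what
  makes the terms of the last sum centred given \<open>F n\<close>.\<close>

lemma omd_stochastic:
  fixes \<psi> :: "'a::euclidean_space \<Rightarrow> real"
  assumes X: "convex X" "compact X" and \<psi>: "distance_generating X X0 \<psi>" "prox_closed X X0 \<psi>"
    "strongly_convex_on X N \<mu> \<psi>" and N: "is_norm N"
    and pos: "\<mu> > 0" "D > 0" "C > 0" "T \<ge> 1" and \<eta>: "\<eta> = sqrt (4 * \<mu> * D / (5 * real T * C))"
    and x0: "x0 \<in> X0" "\<And>\<omega>. \<omega> \<in> space M \<Longrightarrow> x 0 \<omega> = x0"
    and step: "\<And>n \<omega>. n < T \<Longrightarrow> \<omega> \<in> space M \<Longrightarrow>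
      is_arg_min (\<lambda>y. g n \<omega> \<bullet> y + 1 / \<eta> * bregman \<psi> y (x n \<omega>)) (\<lambda>y. y \<in> X) (x (Suc n) \<omega>)"
    and F: "\<And>n. n \<le> T \<Longrightarrow> subalgebra M (F n)" "\<And>n. n < T \<Longrightarrow> subalgebra (F (Suc n)) (F n)"
    and g: "\<And>n. n < T \<Longrightarrow> g n \<in> borel_measurable (F (Suc n))"
    and G: "\<And>n. n < T \<Longrightarrow> G n \<in> borel_measurable (F n)"
    and C: "\<And>n. n < T \<Longrightarrow> AE \<omega> in M. (dual_norm N (g n \<omega>))\<^sup>2 \<le> C"
      "\<And>n. n < T \<Longrightarrow> AE \<omega> in M. (dual_norm N (G n \<omega>))\<^sup>2 \<le> C"
  obtains u where
    "\<And>n. n \<le> T \<Longrightarrow> u n \<in> borel_measurable (F n)"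
    "\<And>n \<omega>. n \<le> T \<Longrightarrow> \<omega> \<in> space M \<Longrightarrow> u n \<omega> \<in> X"
    "AE \<omega> in M. \<forall>z\<in>X. bregman \<psi> z x0 \<le> D \<longrightarrow>
      (\<Sum>n<T. G n \<omega> \<bullet> (x n \<omega> - z)) \<le> real T * sqrt (20 * D * C / (\<mu> * real T))
        + (\<Sum>n<T. (G n \<omega> - g n \<omega>) \<bullet> (x n \<omega> - u n \<omega>))"
proof -
  have \<eta>0: "\<eta> > 0" using pos unfolding \<eta> by simp
  have ne: "X \<noteq> {}" using x0(1) distance_generatingD(1)[OF \<psi>(1)] by auto
  define u where "u = (\<lambda>n \<omega>. omd_iterate X \<psi> \<eta> x0 (\<lambda>n. G n \<omega> - g n \<omega>) n)"
  have u0: "u 0 \<omega> = x0" for \<omega> by (simp add: u_def)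
  have ustep: "is_arg_min (\<lambda>y. (G n \<omega> - g n \<omega>) \<bullet> y + 1 / \<eta> * bregman \<psi> y (u n \<omega>)) (\<lambda>y. y \<in> X) (u (Suc n) \<omega>)"
    for n \<omega> unfolding is_arg_min_bregman_iff
    unfolding u_def omd_iterate.simps
    by (rule is_arg_min_prox[OF X(2) ne distance_generatingD(2)[OF \<psi>(1)]])
  have "u n \<in> borel_measurable (F n)" if "n \<le> T" for n
  proof (rule omd_measurable[where x = u and F = F, OF X \<psi> N pos(1) \<eta>0 x0(1) u0 ustep _ F(2) _ that])
    fix n assume n: "n < T"
    have "G n \<in> borel_measurable (F (Suc n))" using G F(2) n by (auto intro: measurable_from_subalg)
    then show "(\<lambda>\<omega>. G n \<omega> - g n \<omega>) \<in> borel_measurable (F (Suc n))" using g[OF n] by measurable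
  qed (use F(1) in \<open>auto simp: subalgebra_def\<close>)
  moreover have "u n \<omega> \<in> X" for n \<omega>
    using omd_iterates_in[where x = "\<lambda>n. u n \<omega>", OF \<psi>(2) \<eta>0 _ ustep, of n n]
      x0(1) distance_generatingD(1)[OF \<psi>(1)] by (auto simp: u0)
  moreover have "AE \<omega> in M. \<forall>z\<in>X. bregman \<psi> z x0 \<le> D \<longrightarrow>
      (\<Sum>n<T. G n \<omega> \<bullet> (x n \<omega> - z)) \<le> real T * sqrt (20 * D * C / (\<mu> * real T))
        + (\<Sum>n<T. (G n \<omega> - g n \<omega>) \<bullet> (x n \<omega> - u n \<omega>))"
  proof -
    have "AE \<omega> in M. \<forall>n\<in>{..<T}. (dual_norm N (g n \<omega>))\<^sup>2 \<le> C"
      "AE \<omega> in M. \<forall>n\<in>{..<T}. (dual_norm N (G n \<omega>))\<^sup>2 \<le> C"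
      using C by (auto intro!: AE_finite_allI)
    then show ?thesis using AE_space
    proof eventually_elim
      case (elim \<omega>)
      show ?case
      proof (intro ballI impI)
        fix z assume z: "z \<in> X" and D: "bregman \<psi> z x0 \<le> D"
        have "(\<Sum>n<T. G n \<omega> \<bullet> (x n \<omega> - z)) \<le> 2 * bregman \<psi> z (x 0 \<omega>) / \<eta> + real T * (5 * \<eta> / (2 * \<mu>) * C)
            + (\<Sum>n<T. (G n \<omega> - g n \<omega>) \<bullet> (x n \<omega> - u n \<omega>))"
          using elim x0 by (intro omd_ghost_regret[where x = "\<lambda>n. x n \<omega>" and u = "\<lambda>n. u n \<omega>",
              OF X(1) \<psi> N pos(1) \<eta>0 _ _ z step ustep]) (auto simp: u0)
        also have "2 * bregman \<psi> z (x 0 \<omega>) / \<eta> \<le> 2 * D / \<eta>"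
          using D \<eta>0 x0(2) elim by (intro divide_right_mono) auto
        finally show "(\<Sum>n<T. G n \<omega> \<bullet> (x n \<omega> - z)) \<le> real T * sqrt (20 * D * C / (\<mu> * real T))
            + (\<Sum>n<T. (G n \<omega> - g n \<omega>) \<bullet> (x n \<omega> - u n \<omega>))"
          using omd_step_size[OF pos \<eta>] by simp
      qed
    qed
  qed
  ultimately show ?thesis using that by blast
qed


section \<open>Martingale concentration\<close>

text \<open>The logarithmic inequality behind Hoeffding's lemma with probability 1/2 and width
  \<open>2 * \<bar>x\<bar>\<close>, the case of a fair sign. Evenness of \<open>cosh\<close> removes
  the absolute value.\<close>

lemma cosh_le_exp: "cosh (x::real) \<le> exp (x\<^sup>2 / 2)"
proof -
  have "- (2 * \<bar>x\<bar>) * (1 / 2) + ln (1 + 1 / 2 * (exp (2 * \<bar>x\<bar>) - 1)) \<le> (2 * \<bar>x\<bar>)\<^sup>2 / 8"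
    by (rule Hoeffdings_lemma_aux) auto
  then have "ln ((1 + exp (2 * \<bar>x\<bar>)) / 2) \<le> \<bar>x\<bar> + x\<^sup>2 / 2"
    by (simp add: power_mult_distrib field_simps)
  then have "(1 + exp (2 * \<bar>x\<bar>)) / 2 \<le> exp (\<bar>x\<bar> + x\<^sup>2 / 2)"
    by (subst ln_le_cancel_iff[symmetric]) (auto intro: add_pos_pos)
  then have "exp (- \<bar>x\<bar>) * ((1 + exp (2 * \<bar>x\<bar>)) / 2) \<le> exp (- \<bar>x\<bar>) * exp (\<bar>x\<bar> + x\<^sup>2 / 2)"
    by (intro mult_left_mono) auto
  also have "\<dots> = exp (x\<^sup>2 / 2)" by (simp flip: exp_add)
  also have "exp (- \<bar>x\<bar>) * ((1 + exp (2 * \<bar>x\<bar>)) / 2) = cosh \<bar>x\<bar>"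
    by (simp add: cosh_def field_simps flip: exp_add)
  finally show ?thesis by (simp add: abs_if split: if_splits)
qed

text \<open>The right side is the chord of the convex function \<open>exp (s * x)\<close> over the
  interval from \<open>- c\<close> to \<open>c\<close>. It is affine in \<open>x\<close>, so its
  linear part vanishes under a centred conditional expectation.\<close>

lemma exp_le_cosh_sinh:
  fixes s c x :: real
  assumes "s \<ge> 0" "c > 0" "\<bar>x\<bar> \<le> c"
  shows "exp (s * x) \<le> cosh (s * c) + sinh (s * c) / c * x"
proof -
  define a where "a = (c + x) / (2 * c)"
  have a: "0 \<le> a" "a \<le> 1" using assms by (auto simp: a_def field_simps)
  have "(1 - a) *\<^sub>R (- c) + a *\<^sub>R c = x" using assms by (simp add: a_def field_simps)
  moreover have "exp (s * ((1 - a) *\<^sub>R (- c) + a *\<^sub>R c)) \<le> (1 - a) * exp (s * (- c)) + a * exp (s * c)"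
    using convex_onD[OF convex_on_exp[OF assms(1)] a, of "- c" c] by simp
  moreover have "(1 - a) * exp (s * (- c)) + a * exp (s * c) = cosh (s * c) + sinh (s * c) / c * x"
    using assms by (simp add: a_def cosh_def sinh_def field_simps)
  ultimately show ?thesis by simp
qed

text \<open>\<open>X n\<close> is revealed at time \<open>Suc n\<close> and centred given time
  \<open>n\<close>. Everything is restricted to \<open>T\<close> rounds, since beyond them the batch
  history need not consist of events of \<open>M\<close>.\<close>

locale bounded_martingale_difference = prob_space +
  fixes F :: "nat \<Rightarrow> 'a measure" and X :: "nat \<Rightarrow> 'a \<Rightarrow> real" and c :: real and T :: nat
  assumes F: "\<And>n. n \<le> T \<Longrightarrow> subalgebra M (F n)" "\<And>n. n < T \<Longrightarrow> subalgebra (F (Suc n)) (F n)"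
    and X: "\<And>n. n < T \<Longrightarrow> X n \<in> borel_measurable (F (Suc n))"
    and c: "c > 0" "\<And>n. n < T \<Longrightarrow> AE \<omega> in M. \<bar>X n \<omega>\<bar> \<le> c"
    and diff: "\<And>n. n < T \<Longrightarrow> AE \<omega> in M. real_cond_exp M (F n) (X n) \<omega> = 0"
begin

lemma sum_measurable: "n \<le> T \<Longrightarrow> (\<lambda>\<omega>. \<Sum>k<n. X k \<omega>) \<in> borel_measurable (F n)"
proof (induction n)
  case (Suc n)
  then have [measurable]: "(\<lambda>\<omega>. \<Sum>k<n. X k \<omega>) \<in> borel_measurable (F (Suc n))"
    "X n \<in> borel_measurable (F (Suc n))"
    using F(2)[of n] X by (auto intro: measurable_from_subalg)
  show ?case by simp
qed simp

lemma AE_sum_le: "n \<le> T \<Longrightarrow> AE \<omega> in M. \<bar>\<Sum>k<n. X k \<omega>\<bar> \<le> real n * c"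
proof -
  assume "n \<le> T"
  then have "AE \<omega> in M. \<forall>k\<in>{..<n}. \<bar>X k \<omega>\<bar> \<le> c" using c by (auto intro!: AE_finite_allI)
  then show ?thesis
  proof eventually_elim
    case (elim \<omega>)
    then show ?case using sum_norm_le[of "{..<n}" "\<lambda>k. X k \<omega>" "\<lambda>_. c"] by simp
  qed
qed

lemma exp_sum_integrable:
  assumes "s \<ge> 0" "n \<le> T"
  shows "integrable M (\<lambda>\<omega>. exp (s * (\<Sum>k<n. X k \<omega>)))"
proof (rule integrable_const_bound)
  show "AE \<omega> in M. norm (exp (s * (\<Sum>k<n. X k \<omega>))) \<le> exp (s * (real n * c))"
    using AE_sum_le[OF assms(2)] by eventually_elim (auto intro!: mult_left_mono assms)
  have [measurable]: "(\<lambda>\<omega>. \<Sum>k<n. X k \<omega>) \<in> borel_measurable M"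
    using sum_measurable F(1) assms(2) by (auto intro: measurable_from_subalg)
  show "(\<lambda>\<omega>. exp (s * (\<Sum>k<n. X k \<omega>))) \<in> borel_measurable M" by measurable
qed

text \<open>Each round contributes a factor \<open>cosh (s * c)\<close>: the chord bound is applied
  to the last exponential, and its linear part has expectation 0.\<close>

lemma expectation_exp_sum_le:
  assumes s: "s \<ge> 0" and "n \<le> T"
  shows "expectation (\<lambda>\<omega>. exp (s * (\<Sum>k<n. X k \<omega>))) \<le> exp (s\<^sup>2 * c\<^sup>2 / 2) ^ n"
  using assms(2)
proof (induction n)
  case 0
  then show ?case by (simp add: prob_space)
next
  case (Suc n)
  let ?E = "\<lambda>\<omega>. exp (s * (\<Sum>k<n. X k \<omega>))"
  have n: "n \<le> T" "n < T" using Suc.prems by auto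
  interpret S: finite_measure_subalgebra M "F n"
    using F(1)[OF n(1)] by unfold_locales
  have [measurable]: "(\<lambda>\<omega>. \<Sum>k<n. X k \<omega>) \<in> borel_measurable (F n)"
    using sum_measurable[OF n(1)] .
  have [measurable]: "X n \<in> borel_measurable M"
    using X n F(1)[OF Suc.prems] by (auto intro: measurable_from_subalg)
  have int [simp]: "integrable M ?E" by (rule exp_sum_integrable[OF s n(1)])
  have [measurable]: "?E \<in> borel_measurable M" using int by (rule borel_measurable_integrable)
  have intX: "integrable M (\<lambda>\<omega>. ?E \<omega> * X n \<omega>)"
  proof (rule Bochner_Integration.integrable_bound[OF integrable_mult_right[OF int, of c]])
    show "AE \<omega> in M. norm (?E \<omega> * X n \<omega>) \<le> norm (c * ?E \<omega>)"
      using c(2)[OF n(2)]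
    proof eventually_elim
      case (elim \<omega>)
      then show ?case using c(1) by (simp add: abs_mult mult.commute)
    qed
  qed measurable
  \<comment> \<open>\<open>?E\<close> involves the first \<open>n\<close> differences only, hence is
    \<open>F n\<close>-measurable, and the last difference may be replaced by its conditional
    expectation.\<close>
  have "expectation (\<lambda>\<omega>. ?E \<omega> * X n \<omega>) = expectation (\<lambda>\<omega>. ?E \<omega> * real_cond_exp M (F n) (X n) \<omega>)"
    by (intro S.real_cond_exp_intg(2)[symmetric] intX) auto
  also have "\<dots> = expectation (\<lambda>_. 0)" using diff[OF n(2)] by (intro integral_cong_AE) auto
  finally have 0: "expectation (\<lambda>\<omega>. ?E \<omega> * X n \<omega>) = 0" by simp
  have "expectation (\<lambda>\<omega>. exp (s * (\<Sum>k<Suc n. X k \<omega>)))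
      \<le> expectation (\<lambda>\<omega>. cosh (s * c) * ?E \<omega> + sinh (s * c) / c * (?E \<omega> * X n \<omega>))"
  proof (intro integral_mono_AE exp_sum_integrable[OF s] Suc.prems Bochner_Integration.integrable_add
      integrable_mult_right int intX n(1))
    show "AE \<omega> in M. exp (s * (\<Sum>k<Suc n. X k \<omega>))
        \<le> cosh (s * c) * ?E \<omega> + sinh (s * c) / c * (?E \<omega> * X n \<omega>)"
      using c(2)[OF n(2)]
    proof eventually_elim
      case (elim \<omega>)
      have "exp (s * (\<Sum>k<Suc n. X k \<omega>)) = ?E \<omega> * exp (s * X n \<omega>)"
        by (simp add: distrib_left flip: exp_add)
      also have "\<dots> \<le> ?E \<omega> * (cosh (s * c) + sinh (s * c) / c * X n \<omega>)"
        by (intro mult_left_mono exp_le_cosh_sinh s c(1) elim) auto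
      finally show ?case by (simp add: algebra_simps)
    qed
  qed
  also have "\<dots> = cosh (s * c) * expectation ?E" using int intX 0 by simp
  also have "\<dots> \<le> exp (s\<^sup>2 * c\<^sup>2 / 2) * exp (s\<^sup>2 * c\<^sup>2 / 2) ^ n"
    using Suc.IH[OF n(1)] cosh_le_exp[of "s * c"]
    by (intro mult_mono) (auto simp: power_mult_distrib)
  finally show ?case by simp
qed

lemma azuma_hoeffding:
  assumes "T \<ge> 1" "\<epsilon> \<ge> 0"
  shows "prob {\<omega> \<in> space M. \<epsilon> \<le> (\<Sum>n<T. X n \<omega>)} \<le> exp (- \<epsilon>\<^sup>2 / (2 * real T * c\<^sup>2))"
proof (cases "\<epsilon> = 0")
  case False
  then have \<epsilon>: "\<epsilon> > 0" using assms by simp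
  have T: "real T > 0" using assms by simp
  \<comment> \<open>The minimizer of the exponent
    \<open>real T * (s\<^sup>2 * c\<^sup>2 / 2) - s * \<epsilon>\<close> that Markov's inequality
    produces.\<close>
  define s where "s = \<epsilon> / (c\<^sup>2 * real T)"
  have s: "s > 0" using \<epsilon> T c by (simp add: s_def)
  let ?E = "\<lambda>\<omega>. exp (s * (\<Sum>n<T. X n \<omega>))"
  have "{\<omega> \<in> space M. \<epsilon> \<le> (\<Sum>n<T. X n \<omega>)} = {\<omega> \<in> space M. exp (s * \<epsilon>) \<le> ?E \<omega>}"
    using s by auto
  also have "prob \<dots> \<le> expectation ?E / exp (s * \<epsilon>)"
    using exp_sum_integrable[of s T] s
    by (intro integral_Markov_inequality_measure[where A = "{}"]) auto
  also have "\<dots> \<le> exp (s\<^sup>2 * c\<^sup>2 / 2) ^ T / exp (s * \<epsilon>)"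
    using s by (intro divide_right_mono expectation_exp_sum_le) auto
  also have "\<dots> = exp (real T * (s\<^sup>2 * c\<^sup>2 / 2) - s * \<epsilon>)"
    unfolding exp_diff exp_of_nat_mult ..
  also have "real T * (s\<^sup>2 * c\<^sup>2 / 2) - s * \<epsilon> = - \<epsilon>\<^sup>2 / (2 * real T * c\<^sup>2)"
    using T c by (simp add: s_def power2_eq_square field_simps)
  finally show ?thesis .
qed simp

end

text \<open>A predictable weight comes out of the conditional expectation, and the remaining error
  is centred by the tower property. Boundedness is asked of the weights and only integrability of
  the \<open>Z i\<close>, because the bounds on the stochastic gradients concern the combined
  vectors and not the single estimates.\<close>

lemma (in finite_measure_subalgebra) real_cond_exp_weighted_error:
  assumes "finite I" and V: "\<And>i. V i \<in> borel_measurable F"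
    and b: "\<And>i \<omega>. \<omega> \<in> space M \<Longrightarrow> \<bar>V i \<omega>\<bar> \<le> b"
    and Z: "\<And>i. integrable M (Z i)"
  shows "integrable M (\<lambda>\<omega>. \<Sum>i\<in>I. V i \<omega> * (real_cond_exp M F (Z i) \<omega> - Z i \<omega>))"
    and "AE \<omega> in M. real_cond_exp M F (\<lambda>\<omega>. \<Sum>i\<in>I. V i \<omega> * (real_cond_exp M F (Z i) \<omega> - Z i \<omega>)) \<omega> = 0"
proof -
  let ?d = "\<lambda>i \<omega>. real_cond_exp M F (Z i) \<omega> - Z i \<omega>"
  have d: "integrable M (?d i)" for i
    using Z by (intro Bochner_Integration.integrable_diff real_cond_exp_int(1))
  have VM: "V i \<in> borel_measurable M" for i
    using V measurable_from_subalg[OF subalg] by blast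
  have Vd: "integrable M (\<lambda>\<omega>. V i \<omega> * ?d i \<omega>)" for i
  proof (rule Bochner_Integration.integrable_bound[OF integrable_mult_right[OF d, of b]])
    show "(\<lambda>\<omega>. V i \<omega> * ?d i \<omega>) \<in> borel_measurable M"
      using VM d by measurable
    show "AE \<omega> in M. norm (V i \<omega> * ?d i \<omega>) \<le> norm (b * ?d i \<omega>)"
    proof (rule AE_I2)
      fix \<omega> assume "\<omega> \<in> space M"
      then have "\<bar>V i \<omega>\<bar> \<le> \<bar>b\<bar>" using b[of \<omega> i] by simp
      then show "norm (V i \<omega> * ?d i \<omega>) \<le> norm (b * ?d i \<omega>)"
        unfolding real_norm_def abs_mult by (rule mult_right_mono) simp
    qed
  qed
  then show "integrable M (\<lambda>\<omega>. \<Sum>i\<in>I. V i \<omega> * ?d i \<omega>)" by (rule Bochner_Integration.integrable_sum)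
  have "AE \<omega> in M. real_cond_exp M F (\<lambda>\<omega>. V i \<omega> * ?d i \<omega>) \<omega> = 0" for i
  proof -
    have "AE \<omega> in M. real_cond_exp M F (\<lambda>\<omega>. V i \<omega> * ?d i \<omega>) \<omega> = V i \<omega> * real_cond_exp M F (?d i) \<omega>"
      using V d Vd by (intro real_cond_exp_mult) auto
    moreover have "AE \<omega> in M. real_cond_exp M F (?d i) \<omega>
        = real_cond_exp M F (real_cond_exp M F (Z i)) \<omega> - real_cond_exp M F (Z i) \<omega>"
      using Z by (intro real_cond_exp_diff real_cond_exp_int(1))
    moreover have "AE \<omega> in M. real_cond_exp M F (real_cond_exp M F (Z i)) \<omega> = real_cond_exp M F (Z i) \<omega>"
      using Z by (intro real_cond_exp_F_meas real_cond_exp_int(1)) auto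
    ultimately show ?thesis by eventually_elim simp
  qed
  then have "AE \<omega> in M. \<forall>i\<in>I. real_cond_exp M F (\<lambda>\<omega>. V i \<omega> * ?d i \<omega>) \<omega> = 0"
    using \<open>finite I\<close> by (intro AE_finite_allI) auto
  moreover have "AE \<omega> in M. real_cond_exp M F (\<lambda>\<omega>. \<Sum>i\<in>I. V i \<omega> * ?d i \<omega>) \<omega>
      = (\<Sum>i\<in>I. real_cond_exp M F (\<lambda>\<omega>. V i \<omega> * ?d i \<omega>) \<omega>)"
    by (rule real_cond_exp_sum[OF Vd])
  ultimately show "AE \<omega> in M. real_cond_exp M F (\<lambda>\<omega>. \<Sum>i\<in>I. V i \<omega> * ?d i \<omega>) \<omega> = 0"
    by eventually_elim simp
qed


section \<open>The averaged outputs\<close>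

text \<open>Jensen's inequality with weights \<open>c i / s\<close>, shared by both outputs: weight
  1 on every round, or the final weights of the pool.\<close>

lemma weighted_average:
  fixes x :: "'i \<Rightarrow> 'a::real_vector"
  assumes "finite P" "\<And>i. i \<in> P \<Longrightarrow> 0 \<le> c i" "(\<Sum>i\<in>P. c i) = s" "s > 0" "convex X"
    "\<And>i. i \<in> P \<Longrightarrow> x i \<in> X"
  shows "(1 / s) *\<^sub>R (\<Sum>i\<in>P. c i *\<^sub>R x i) \<in> X"
    and "convex_on X f \<Longrightarrow> f ((1 / s) *\<^sub>R (\<Sum>i\<in>P. c i *\<^sub>R x i)) \<le> 1 / s * (\<Sum>i\<in>P. c i * f (x i))"
proof -
  have eq: "(1 / s) *\<^sub>R (\<Sum>i\<in>P. c i *\<^sub>R x i) = (\<Sum>i\<in>P. (c i / s) *\<^sub>R x i)"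
    by (simp add: scaleR_sum_right)
  have 1: "(\<Sum>i\<in>P. c i / s) = 1" using assms by (simp flip: sum_divide_distrib)
  show "(1 / s) *\<^sub>R (\<Sum>i\<in>P. c i *\<^sub>R x i) \<in> X"
    unfolding eq using assms 1 by (intro convex_sum) auto
  assume f: "convex_on X f"
  have "P \<noteq> {}" using 1 by auto
  then have "f (\<Sum>i\<in>P. (c i / s) *\<^sub>R x i) \<le> (\<Sum>i\<in>P. c i / s * f (x i))"
    using assms 1 f by (intro convex_on_sum) auto
  then show "f ((1 / s) *\<^sub>R (\<Sum>i\<in>P. c i *\<^sub>R x i)) \<le> 1 / s * (\<Sum>i\<in>P. c i * f (x i))"
    unfolding eq by (simp add: sum_divide_distrib)
qed

lemma ada_pool_Suc:
  assumes "ada_pool f \<theta> n = (P, c)"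
    and "A = {\<tau>\<in>P. dominates f (\<theta> \<tau>) (\<theta> (Suc n))}" "B = {\<tau>\<in>P. dominates f (\<theta> (Suc n)) (\<theta> \<tau>)}"
  shows "ada_pool f \<theta> (Suc n) =
    (if A \<noteq> {} then (P, \<lambda>\<tau>. if \<tau> \<in> A then c \<tau> + 1 / real (card A) else c \<tau>)
     else (insert (Suc n) (P - B), c(Suc n := 1 + (\<Sum>\<tau>\<in>B. c \<tau>))))"
  unfolding assms(2,3) ada_pool.simps assms(1) Let_def prod.case by (rule refl)

text \<open>The claims support each other: the index bound makes \<open>Suc n\<close> fresh,
  nonnegative weights ensure that a transfer to a dominating iterate raises no objective, and the
  total weight \<open>n\<close> makes the output a genuine average.\<close>

lemma ada_pool_invariant:
  fixes f :: "'m \<Rightarrow> 'a \<Rightarrow> real"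
  shows "fst (ada_pool f \<theta> n) \<subseteq> {1..n} \<and> (\<forall>\<tau>\<in>fst (ada_pool f \<theta> n). 0 \<le> snd (ada_pool f \<theta> n) \<tau>)
    \<and> (\<Sum>\<tau>\<in>fst (ada_pool f \<theta> n). snd (ada_pool f \<theta> n) \<tau>) = real n
    \<and> (\<forall>i. (\<Sum>\<tau>\<in>fst (ada_pool f \<theta> n). snd (ada_pool f \<theta> n) \<tau> * f i (\<theta> \<tau>)) \<le> (\<Sum>t=1..n. f i (\<theta> t)))"
proof (induction n)
  case (Suc n)
  obtain P c where Pc: "ada_pool f \<theta> n = (P, c)" by (cases "ada_pool f \<theta> n")
  define A where "A = {\<tau>\<in>P. dominates f (\<theta> \<tau>) (\<theta> (Suc n))}"
  define B where "B = {\<tau>\<in>P. dominates f (\<theta> (Suc n)) (\<theta> \<tau>)}"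
  have P: "P \<subseteq> {1..n}" and c: "\<And>\<tau>. \<tau> \<in> P \<Longrightarrow> 0 \<le> c \<tau>" and sum: "(\<Sum>\<tau>\<in>P. c \<tau>) = real n"
    and val: "\<And>i. (\<Sum>\<tau>\<in>P. c \<tau> * f i (\<theta> \<tau>)) \<le> (\<Sum>t=1..n. f i (\<theta> t))"
    using Suc by (auto simp: Pc)
  have fin: "finite P" using P finite_subset by blast
  have sub: "A \<subseteq> P" "B \<subseteq> P" by (auto simp: A_def B_def)
  have finAB: "finite A" "finite B" using sub fin finite_subset by blast+
  show ?case
  proof (cases "A = {}")
    case False
    define c' where "c' = (\<lambda>\<tau>. if \<tau> \<in> A then c \<tau> + 1 / real (card A) else c \<tau>)"
    have pool: "ada_pool f \<theta> (Suc n) = (P, c')"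
      unfolding ada_pool_Suc[OF Pc A_def B_def] c'_def using False by simp
    have card: "real (card A) > 0" using False finAB by (simp add: card_gt_0_iff)
    \<comment> \<open>Stated for arbitrary \<open>h\<close>: an objective along the iterates gives
      the value claim, the constant 1 the total weight.\<close>
    have eq: "(\<Sum>\<tau>\<in>P. c' \<tau> * h \<tau>) = (\<Sum>\<tau>\<in>P. c \<tau> * h \<tau>) + (\<Sum>\<tau>\<in>A. h \<tau>) / real (card A)" for h
    proof -
      have "(\<Sum>\<tau>\<in>P. c' \<tau> * h \<tau>) = (\<Sum>\<tau>\<in>P. c \<tau> * h \<tau> + (if \<tau> \<in> A then h \<tau> / real (card A) else 0))"
        by (intro sum.cong) (auto simp: c'_def algebra_simps)
      also have "\<dots> = (\<Sum>\<tau>\<in>P. c \<tau> * h \<tau>) + (\<Sum>\<tau>\<in>P \<inter> A. h \<tau> / real (card A))"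
        using fin by (simp add: sum.distrib sum.inter_restrict)
      also have "P \<inter> A = A" using sub by auto
      finally show ?thesis by (simp add: sum_divide_distrib)
    qed
    \<comment> \<open>The new unit of weight is charged the mean of \<open>f i\<close> over
      \<open>A\<close>, which is at most its value at the new iterate.\<close>
    have "(\<Sum>\<tau>\<in>A. f i (\<theta> \<tau>)) \<le> real (card A) * f i (\<theta> (Suc n))" for i
      by (intro sum_bounded_above) (auto simp: A_def dominates_def)
    then have "(\<Sum>\<tau>\<in>A. f i (\<theta> \<tau>)) / real (card A) \<le> f i (\<theta> (Suc n))" for i
      using card by (simp add: pos_divide_le_eq mult.commute)
    then have "(\<Sum>\<tau>\<in>P. c' \<tau> * f i (\<theta> \<tau>)) \<le> (\<Sum>t=1..Suc n. f i (\<theta> t))" for i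
      using val[of i] by (simp add: eq add_mono)
    moreover have "(\<Sum>\<tau>\<in>P. c' \<tau>) = real (Suc n)" using eq[of "\<lambda>_. 1"] sum card by simp
    ultimately show ?thesis using P c card unfolding pool by (auto simp: c'_def)
  next
    case True
    define c' where "c' = c(Suc n := 1 + (\<Sum>\<tau>\<in>B. c \<tau>))"
    have pool: "ada_pool f \<theta> (Suc n) = (insert (Suc n) (P - B), c')"
      unfolding ada_pool_Suc[OF Pc A_def B_def] c'_def using True by simp
    have new: "Suc n \<notin> P" using P by auto
    \<comment> \<open>The weights removed with \<open>B\<close> reappear at the new index. The last
      sum is the effect of this transfer: nonpositive for an objective, zero for the constant
      1.\<close>
    have eq: "(\<Sum>\<tau>\<in>insert (Suc n) (P - B). c' \<tau> * h \<tau>)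
        = (\<Sum>\<tau>\<in>P. c \<tau> * h \<tau>) + h (Suc n) + (\<Sum>\<tau>\<in>B. c \<tau> * (h (Suc n) - h \<tau>))" for h
    proof -
      have "(\<Sum>\<tau>\<in>insert (Suc n) (P - B). c' \<tau> * h \<tau>) = c' (Suc n) * h (Suc n) + (\<Sum>\<tau>\<in>P - B. c' \<tau> * h \<tau>)"
        using new fin by simp
      also have "(\<Sum>\<tau>\<in>P - B. c' \<tau> * h \<tau>) = (\<Sum>\<tau>\<in>P - B. c \<tau> * h \<tau>)"
        using new by (intro sum.cong) (auto simp: c'_def)
      also have "\<dots> = (\<Sum>\<tau>\<in>P. c \<tau> * h \<tau>) - (\<Sum>\<tau>\<in>B. c \<tau> * h \<tau>)"
        using fin sub by (intro sum_diff)
      finally show ?thesis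
        by (simp add: c'_def distrib_right right_diff_distrib sum_subtractf sum_distrib_right)
    qed
    have "(\<Sum>\<tau>\<in>B. c \<tau> * (f i (\<theta> (Suc n)) - f i (\<theta> \<tau>))) \<le> 0" for i
      using sub c by (intro sum_nonpos mult_nonneg_nonpos) (auto simp: B_def dominates_def)
    then have "(\<Sum>\<tau>\<in>insert (Suc n) (P - B). c' \<tau> * f i (\<theta> \<tau>)) \<le> (\<Sum>t=1..Suc n. f i (\<theta> t))" for i
      unfolding eq using val[of i] by (simp add: add_decreasing2)
    moreover have "(\<Sum>\<tau>\<in>insert (Suc n) (P - B). c' \<tau>) = real (Suc n)"
      using eq[of "\<lambda>_. 1"] sum by simp
    moreover have "0 \<le> (\<Sum>\<tau>\<in>B. c \<tau>)" using sub c by (intro sum_nonneg) auto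
    ultimately show ?thesis using P c unfolding pool by (auto simp: c'_def)
  qed
qed simp

lemma uniform_average:
  assumes "T \<ge> 1" "convex X" "\<And>t. t \<in> {1..T} \<Longrightarrow> \<theta> t \<in> X"
  shows "uniform_average \<theta> T \<in> X"
    and "convex_on X f \<Longrightarrow> f (uniform_average \<theta> T) \<le> 1 / real T * (\<Sum>t=1..T. f (\<theta> t))"
  using weighted_average[of "{1..T}" "\<lambda>_. 1" "real T" X \<theta>] assms
  by (auto simp: uniform_average_def)

lemma adaptive_average:
  assumes "T \<ge> 1" "convex X" "\<And>t. t \<in> {1..T} \<Longrightarrow> \<theta> t \<in> X"
  shows "adaptive_average f \<theta> T \<in> X"
    and "convex_on X (f i) \<Longrightarrow> f i (adaptive_average f \<theta> T) \<le> 1 / real T * (\<Sum>t=1..T. f i (\<theta> t))"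
proof -
  let ?P = "fst (ada_pool f \<theta> T)" and ?c = "snd (ada_pool f \<theta> T)"
  note inv = ada_pool_invariant[of f \<theta> T]
  have fin: "finite ?P" using inv finite_subset by blast
  have c: "\<And>\<tau>. \<tau> \<in> ?P \<Longrightarrow> 0 \<le> ?c \<tau>" "(\<Sum>\<tau>\<in>?P. ?c \<tau>) = real T" and X: "\<And>\<tau>. \<tau> \<in> ?P \<Longrightarrow> \<theta> \<tau> \<in> X"
    and T: "real T > 0"
    using inv assms(1,3) by auto
  show "adaptive_average f \<theta> T \<in> X"
    unfolding adaptive_average_def by (rule weighted_average(1)[OF fin c T assms(2) X])
  assume f: "convex_on X (f i)"
  have "f i (adaptive_average f \<theta> T) \<le> 1 / real T * (\<Sum>\<tau>\<in>?P. ?c \<tau> * f i (\<theta> \<tau>))"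
    unfolding adaptive_average_def
    by (rule weighted_average(2)[OF fin _ c(2) T assms(2) _ f]) (use c X in auto)
  also have "\<dots> \<le> 1 / real T * (\<Sum>t=1..T. f i (\<theta> t))"
    using inv by (intro mult_left_mono) auto
  finally show "f i (adaptive_average f \<theta> T) \<le> 1 / real T * (\<Sum>t=1..T. f i (\<theta> t))" .
qed

text \<open>The random pool is described index by index, through membership and weight. The output
  enters the event of the theorem, and a nonmeasurable set has measure 0 by convention, so the lower
  bound on the probability depends on this.\<close>

lemma ada_pool_measurable:
  fixes f :: "'m::finite \<Rightarrow> 'a \<Rightarrow> real"
  assumes meas: "\<And>i t. t \<in> {1..T} \<Longrightarrow> (\<lambda>\<omega>. f i (\<theta> t \<omega>)) \<in> borel_measurable M"
  shows "n \<le> T \<Longrightarrow> (\<forall>\<tau>. Measurable.pred M (\<lambda>\<omega>. \<tau> \<in> fst (ada_pool f (\<lambda>t. \<theta> t \<omega>) n)))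
    \<and> (\<forall>\<tau>. (\<lambda>\<omega>. snd (ada_pool f (\<lambda>t. \<theta> t \<omega>) n) \<tau>) \<in> borel_measurable M)"
proof (induction n)
  case (Suc n)
  define P where "P = (\<lambda>\<omega>. fst (ada_pool f (\<lambda>t. \<theta> t \<omega>) n))"
  define c where "c = (\<lambda>\<omega>. snd (ada_pool f (\<lambda>t. \<theta> t \<omega>) n))"
  define A where "A = (\<lambda>\<omega>. {\<tau>\<in>P \<omega>. dominates f (\<theta> \<tau> \<omega>) (\<theta> (Suc n) \<omega>)})"
  define B where "B = (\<lambda>\<omega>. {\<tau>\<in>P \<omega>. dominates f (\<theta> (Suc n) \<omega>) (\<theta> \<tau> \<omega>)})"
  have Psub: "P \<omega> \<subseteq> {1..n}" for \<omega> using ada_pool_invariant[of f "\<lambda>t. \<theta> t \<omega>" n] by (simp add: P_def)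
  have AB_sub: "A \<omega> \<subseteq> {1..n}" "B \<omega> \<subseteq> {1..n}" for \<omega> using Psub by (auto simp: A_def B_def)
  have Pm [measurable]: "Measurable.pred M (\<lambda>\<omega>. \<tau> \<in> P \<omega>)" for \<tau> using Suc by (simp add: P_def)
  have cm [measurable]: "(\<lambda>\<omega>. c \<omega> \<tau>) \<in> borel_measurable M" for \<tau> using Suc by (simp add: c_def)
  have dom: "Measurable.pred M (\<lambda>\<omega>. dominates f (\<theta> s \<omega>) (\<theta> t \<omega>))" if "s \<in> {1..T}" "t \<in> {1..T}" for s t
  proof -
    have [measurable]: "(\<lambda>\<omega>. f i (\<theta> s \<omega>)) \<in> borel_measurable M" "(\<lambda>\<omega>. f i (\<theta> t \<omega>)) \<in> borel_measurable M" for i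
      using that by (auto intro: meas)
    show ?thesis unfolding dominates_def by measurable
  qed
  have n: "Suc n \<in> {1..T}" using Suc.prems by auto
  have Am [measurable]: "Measurable.pred M (\<lambda>\<omega>. \<tau> \<in> A \<omega>)" for \<tau>
  \<comment> \<open>Iterates are known to be measurable only in rounds up to \<open>T\<close>;
    indices outside \<open>{1..n}\<close> never belong to the pool.\<close>
  proof (cases "\<tau> \<in> {1..n}")
    case True
    then have [measurable]: "Measurable.pred M (\<lambda>\<omega>. dominates f (\<theta> \<tau> \<omega>) (\<theta> (Suc n) \<omega>))"
      using n by (intro dom) auto
    show ?thesis unfolding A_def mem_Collect_eq by measurable
  next
    case False
    then have "(\<lambda>\<omega>. \<tau> \<in> A \<omega>) = (\<lambda>_. False)" using AB_sub by blast
    then show ?thesis by simp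
  qed
  have Bm [measurable]: "Measurable.pred M (\<lambda>\<omega>. \<tau> \<in> B \<omega>)" for \<tau>
  proof (cases "\<tau> \<in> {1..n}")
    case True
    then have [measurable]: "Measurable.pred M (\<lambda>\<omega>. dominates f (\<theta> (Suc n) \<omega>) (\<theta> \<tau> \<omega>))"
      using n by (intro dom) auto
    show ?thesis unfolding B_def mem_Collect_eq by measurable
  next
    case False
    then have "(\<lambda>\<omega>. \<tau> \<in> B \<omega>) = (\<lambda>_. False)" using AB_sub by blast
    then show ?thesis by simp
  qed
  have ne: "A \<omega> \<noteq> {} \<longleftrightarrow> (\<exists>\<tau>\<in>{1..n}. \<tau> \<in> A \<omega>)" for \<omega> using AB_sub by blast
  \<comment> \<open>Sums over a random index set become sums over fixed rounds with an
    indicator.\<close>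
  have sum: "(\<Sum>\<tau>\<in>S. h \<tau>) = (\<Sum>\<tau>=1..n. if \<tau> \<in> S then h \<tau> else 0)"
    if "S \<subseteq> {1..n}" for S and h :: "nat \<Rightarrow> real"
    using that by (subst sum.inter_restrict[symmetric]) (auto simp: Int_absorb1)
  have card: "real (card (A \<omega>)) = (\<Sum>\<tau>=1..n. if \<tau> \<in> A \<omega> then 1 else 0)" for \<omega>
    using sum[OF AB_sub(1), of "\<lambda>_. 1"] by simp
  have "ada_pool f (\<lambda>t. \<theta> t \<omega>) n = (P \<omega>, c \<omega>)" for \<omega> by (simp add: P_def c_def)
  note pool = ada_pool_Suc[OF this A_def[THEN fun_cong] B_def[THEN fun_cong]]
  have fst: "fst (ada_pool f (\<lambda>t. \<theta> t \<omega>) (Suc n))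
      = (if \<exists>\<tau>\<in>{1..n}. \<tau> \<in> A \<omega> then P \<omega> else insert (Suc n) (P \<omega> - B \<omega>))" for \<omega>
    unfolding pool ne[symmetric] by simp
  have snd: "snd (ada_pool f (\<lambda>t. \<theta> t \<omega>) (Suc n)) \<tau>
      = (if \<exists>\<tau>\<in>{1..n}. \<tau> \<in> A \<omega>
         then if \<tau> \<in> A \<omega> then c \<omega> \<tau> + 1 / (\<Sum>\<tau>=1..n. if \<tau> \<in> A \<omega> then 1 else 0) else c \<omega> \<tau>
         else if \<tau> = Suc n then 1 + (\<Sum>\<tau>=1..n. if \<tau> \<in> B \<omega> then c \<omega> \<tau> else 0) else c \<omega> \<tau>)" for \<omega> \<tau>
    unfolding pool card[symmetric] sum[OF AB_sub(2), symmetric] ne[symmetric] by simp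
  have "Measurable.pred M (\<lambda>\<omega>. \<tau> \<in> fst (ada_pool f (\<lambda>t. \<theta> t \<omega>) (Suc n)))" for \<tau>
  proof -
    have "(\<lambda>\<omega>. \<tau> \<in> fst (ada_pool f (\<lambda>t. \<theta> t \<omega>) (Suc n)))
      = (\<lambda>\<omega>. if \<exists>\<tau>\<in>{1..n}. \<tau> \<in> A \<omega> then \<tau> \<in> P \<omega> else \<tau> = Suc n \<or> \<tau> \<in> P \<omega> \<and> \<not> \<tau> \<in> B \<omega>)"
      unfolding fst by auto
    then show ?thesis by simp
  qed
  moreover have "(\<lambda>\<omega>. snd (ada_pool f (\<lambda>t. \<theta> t \<omega>) (Suc n)) \<tau>) \<in> borel_measurable M" for \<tau>
    unfolding snd by measurable
  ultimately show ?case by blast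
qed simp

lemma adaptive_average_measurable:
  fixes f :: "'m::finite \<Rightarrow> 'a::euclidean_space \<Rightarrow> real"
  assumes "\<And>i t. t \<in> {1..T} \<Longrightarrow> (\<lambda>\<omega>. f i (\<theta> t \<omega>)) \<in> borel_measurable M"
    and "\<And>t. t \<in> {1..T} \<Longrightarrow> \<theta> t \<in> borel_measurable M"
  shows "(\<lambda>\<omega>. adaptive_average f (\<lambda>t. \<theta> t \<omega>) T) \<in> borel_measurable M"
proof -
  let ?P = "\<lambda>\<omega>. fst (ada_pool f (\<lambda>t. \<theta> t \<omega>) T)" and ?c = "\<lambda>\<omega>. snd (ada_pool f (\<lambda>t. \<theta> t \<omega>) T)"
  have [measurable]: "Measurable.pred M (\<lambda>\<omega>. \<tau> \<in> ?P \<omega>)" "(\<lambda>\<omega>. ?c \<omega> \<tau>) \<in> borel_measurable M" for \<tau>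
    using ada_pool_measurable[of T f \<theta> M T] assms(1) by auto
  have "adaptive_average f (\<lambda>t. \<theta> t \<omega>) T
      = (1 / real T) *\<^sub>R (\<Sum>\<tau>=1..T. if \<tau> \<in> ?P \<omega> then ?c \<omega> \<tau> *\<^sub>R \<theta> \<tau> \<omega> else 0)" for \<omega>
    using ada_pool_invariant[of f "\<lambda>t. \<theta> t \<omega>" T] unfolding adaptive_average_def
    by (subst sum.inter_restrict[symmetric]) (auto simp: Int_absorb1)
  moreover have "(\<lambda>\<omega>. (1 / real T) *\<^sub>R (\<Sum>\<tau>=1..T. if \<tau> \<in> ?P \<omega> then ?c \<omega> \<tau> *\<^sub>R \<theta> \<tau> \<omega> else 0))
      \<in> borel_measurable M"
  proof (intro borel_measurable_scaleR borel_measurable_const borel_measurable_sum)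
    fix \<tau> assume "\<tau> \<in> {1..T}"
    then have [measurable]: "\<theta> \<tau> \<in> borel_measurable M" by (rule assms(2))
    show "(\<lambda>\<omega>. if \<tau> \<in> ?P \<omega> then ?c \<omega> \<tau> *\<^sub>R \<theta> \<tau> \<omega> else 0) \<in> borel_measurable M" by measurable
  qed
  ultimately show ?thesis by simp
qed


section \<open>The duality gap\<close>

lemma compact_prob_simplex: "compact (prob_simplex :: (real ^ 'm::finite) set)"
proof -
  have "prob_simplex = {\<alpha>::real ^ 'm. (\<Sum>i\<in>UNIV. \<alpha> $ i) = 1} \<inter> (\<Inter>i. {\<alpha>. 0 \<le> \<alpha> $ i})"
    by (auto simp: prob_simplex_def)
  also have "closed \<dots>"
    by (intro closed_Int closed_INT ballI closed_Collect_eq closed_Collect_le continuous_intros)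
  finally have "closed (prob_simplex :: (real ^ 'm) set)" .
  moreover have "norm \<alpha> \<le> 1" if "\<alpha> \<in> prob_simplex" for \<alpha> :: "real ^ 'm"
    using norm_le_l1_cart[of \<alpha>] that by (auto simp: prob_simplex_def)
  then have "bounded (prob_simplex :: (real ^ 'm) set)" by (auto simp: bounded_iff)
  ultimately show ?thesis by (simp add: compact_eq_bounded_closed)
qed

lemma convex_prob_simplex: "convex (prob_simplex :: (real ^ 'm::finite) set)"
  by (rule convexI) (auto simp: prob_simplex_def sum.distrib simp flip: sum_distrib_left)

lemma axis_in_prob_simplex: "axis i 1 \<in> (prob_simplex :: (real ^ 'm::finite) set)"
  by (auto simp: prob_simplex_def axis_def)

lemma prob_simplex_le_1:
  assumes "\<alpha> \<in> prob_simplex"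
  shows "\<alpha> $ i \<le> 1"
proof -
  have "\<alpha> $ i \<le> (\<Sum>i\<in>UNIV. \<alpha> $ i)"
    using assms by (intro member_le_sum) (auto simp: prob_simplex_def)
  then show ?thesis using assms by (simp add: prob_simplex_def)
qed

text \<open>The dual norm constants bound gradients of the Lagrangian; this and its counterpart in
  \<open>l\<close> translate them into the explicit vectors that occur in the duality gap.\<close>

lemma gradient_lagrangian_theta:
  fixes f :: "'m::finite \<Rightarrow> 'a::euclidean_space \<Rightarrow> real"
  assumes "\<And>i. f i differentiable (at x)"
  shows "gradient (\<lambda>x. lagrangian f w x l) x = (\<Sum>i\<in>UNIV. (l $ i * w $ i) *\<^sub>R gradient (f i) x)"
proof (rule gradient_eqI)
  have "((\<lambda>x. lagrangian f w x l) has_derivative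
      (\<lambda>h. \<Sum>i\<in>UNIV. l $ i * w $ i * (h \<bullet> gradient (f i) x))) (at x)"
    unfolding lagrangian_def
    using GDERIV_gradient[OF assms] by (intro has_derivative_sum has_derivative_mult_right) (auto simp: gderiv_def)
  then show "GDERIV (\<lambda>x. lagrangian f w x l) x :> (\<Sum>i\<in>UNIV. (l $ i * w $ i) *\<^sub>R gradient (f i) x)"
    unfolding gderiv_def by (simp add: inner_sum_right)
qed

lemma lagrangian_eq_inner: "lagrangian f w \<theta> l = (\<chi> i. w $ i * f i \<theta>) \<bullet> l"
  by (simp add: lagrangian_def inner_vec_def mult_ac)

lemma gradient_lagrangian_lam: "gradient (\<lambda>l. lagrangian f w \<theta> l) l = (\<chi> i. w $ i * f i \<theta>)"
  unfolding lagrangian_eq_inner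
  by (rule gradient_eqI) (auto simp: gderiv_def inner_commute intro!: derivative_eq_intros)

lemma lagrangian_le_TCH:
  fixes f :: "'m::finite \<Rightarrow> 'a \<Rightarrow> real"
  assumes "l \<in> prob_simplex"
  shows "lagrangian f w \<theta> l \<le> TCH f w \<theta>"
proof -
  have "lagrangian f w \<theta> l \<le> (\<Sum>i\<in>UNIV. l $ i * TCH f w \<theta>)"
    unfolding lagrangian_def mult.assoc using assms
    by (intro sum_mono mult_left_mono) (auto simp: TCH_def prob_simplex_def)
  then show ?thesis using assms by (simp add: prob_simplex_def flip: sum_distrib_right)
qed

text \<open>It suffices to test the vertices of the simplex, where the Lagrangian is a single
  \<open>w $ i * f i \<theta>\<close>.\<close>

lemma TCH_le_lagrangian:
  fixes f :: "'m::finite \<Rightarrow> 'a \<Rightarrow> real"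
  assumes "is_arg_max (\<lambda>l. lagrangian f w \<theta> l) (\<lambda>l. l \<in> prob_simplex) l"
  shows "TCH f w \<theta> \<le> lagrangian f w \<theta> l"
proof -
  have "w $ i * f i \<theta> \<le> lagrangian f w \<theta> l" for i
  proof -
    have "w $ i * f i \<theta> = lagrangian f w \<theta> (axis i 1)"
      by (simp add: lagrangian_eq_inner inner_axis)
    also have "\<dots> \<le> lagrangian f w \<theta> l"
      using assms axis_in_prob_simplex[of i] by (auto simp: is_arg_max_linorder)
    finally show ?thesis .
  qed
  then show ?thesis by (auto simp: TCH_def)
qed

text \<open>From above, the Lagrangian at the maximizing weights is bounded by its average over the
  rounds; from below, weak duality puts its minimum at the averaged weights under the infimum. In
  round \<open>t\<close> the difference splits at
  \<open>lagrangian f w (\<theta> t) (lam t)\<close>: convexity bounds one part, linearity evaluates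
  the other, with a minus sign because this player maximizes.\<close>

lemma TCH_gap_le:
  fixes f :: "'m::finite \<Rightarrow> 'a::euclidean_space \<Rightarrow> real"
  assumes T: "T \<ge> 1" and w: "w \<in> prob_simplex" and \<Theta>: "\<Theta> \<noteq> {}"
    and f: "\<And>i. convex_on \<Theta> (f i)" "\<And>i x. x \<in> \<Theta> \<Longrightarrow> f i differentiable (at x)"
    and iter: "\<And>t. t \<in> {1..T} \<Longrightarrow> \<theta> t \<in> \<Theta>" "\<And>t. t \<in> {1..T} \<Longrightarrow> lam t \<in> prob_simplex"
    and hat: "\<And>i. f i \<theta>_hat \<le> 1 / real T * (\<Sum>t=1..T. f i (\<theta> t))"
    and \<theta>_star: "is_arg_min (\<lambda>x. lagrangian f w x (uniform_average lam T)) (\<lambda>x. x \<in> \<Theta>) \<theta>_star"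
    and lam_star: "is_arg_max (\<lambda>l. lagrangian f w \<theta>_hat l) (\<lambda>l. l \<in> prob_simplex) lam_star"
  shows "TCH f w \<theta>_hat - (INF x\<in>\<Theta>. TCH f w x) \<le> 1 / real T *
    ((\<Sum>t=1..T. (\<Sum>i\<in>UNIV. (lam t $ i * w $ i) *\<^sub>R gradient (f i) (\<theta> t)) \<bullet> (\<theta> t - \<theta>_star))
     + (\<Sum>t=1..T. - (\<chi> i. w $ i * f i (\<theta> t)) \<bullet> (lam t - lam_star)))"
proof -
  have w0: "0 \<le> w $ i" for i using w by (simp add: prob_simplex_def)
  have lam_star_in: "lam_star \<in> prob_simplex" and \<theta>_star_in: "\<theta>_star \<in> \<Theta>"
    using lam_star \<theta>_star by (auto simp: is_arg_max_def is_arg_min_def)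
  have "TCH f w \<theta>_hat \<le> lagrangian f w \<theta>_hat lam_star" by (rule TCH_le_lagrangian[OF lam_star])
  also have "\<dots> \<le> (\<Sum>i\<in>UNIV. lam_star $ i * w $ i * (1 / real T * (\<Sum>t=1..T. f i (\<theta> t))))"
    unfolding lagrangian_def using lam_star_in w0
    by (intro sum_mono mult_left_mono hat) (auto simp: prob_simplex_def)
  also have "\<dots> = 1 / real T * (\<Sum>t=1..T. lagrangian f w (\<theta> t) lam_star)"
    unfolding lagrangian_def by (subst sum.swap) (simp add: sum_distrib_left sum_distrib_right sum_divide_distrib)
  finally have up: "TCH f w \<theta>_hat \<le> 1 / real T * (\<Sum>t=1..T. lagrangian f w (\<theta> t) lam_star)" .
  have "lagrangian f w \<theta>_star (uniform_average lam T) \<le> (INF x\<in>\<Theta>. TCH f w x)"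
  proof (rule cINF_greatest[OF \<Theta>])
    fix x assume "x \<in> \<Theta>"
    then have "lagrangian f w \<theta>_star (uniform_average lam T) \<le> lagrangian f w x (uniform_average lam T)"
      using \<theta>_star by (auto simp: is_arg_min_linorder)
    also have "\<dots> \<le> TCH f w x"
      by (intro lagrangian_le_TCH uniform_average(1) T convex_prob_simplex iter)
    finally show "lagrangian f w \<theta>_star (uniform_average lam T) \<le> TCH f w x" .
  qed
  moreover have "lagrangian f w \<theta>_star (uniform_average lam T)
      = 1 / real T * (\<Sum>t=1..T. lagrangian f w \<theta>_star (lam t))"
    by (simp add: lagrangian_eq_inner uniform_average_def inner_sum_right)
  ultimately have "TCH f w \<theta>_hat - (INF x\<in>\<Theta>. TCH f w x)
      \<le> 1 / real T * (\<Sum>t=1..T. lagrangian f w (\<theta> t) lam_star - lagrangian f w \<theta>_star (lam t))"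
    using up by (simp add: sum_subtractf right_diff_distrib diff_divide_distrib)
  also have "\<dots> \<le> 1 / real T * (\<Sum>t=1..T.
      (\<Sum>i\<in>UNIV. (lam t $ i * w $ i) *\<^sub>R gradient (f i) (\<theta> t)) \<bullet> (\<theta> t - \<theta>_star)
      + - (\<chi> i. w $ i * f i (\<theta> t)) \<bullet> (lam t - lam_star))"
  proof (intro mult_left_mono sum_mono)
    fix t assume t: "t \<in> {1..T}"
    have "lagrangian f w (\<theta> t) (lam t) - lagrangian f w \<theta>_star (lam t)
        = (\<Sum>i\<in>UNIV. lam t $ i * w $ i * (f i (\<theta> t) - f i \<theta>_star))"
      by (simp add: lagrangian_def right_diff_distrib sum_subtractf)
    also have "\<dots> \<le> (\<Sum>i\<in>UNIV. lam t $ i * w $ i * (gradient (f i) (\<theta> t) \<bullet> (\<theta> t - \<theta>_star)))"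
    proof (intro sum_mono mult_left_mono)
      fix i
      show "f i (\<theta> t) - f i \<theta>_star \<le> gradient (f i) (\<theta> t) \<bullet> (\<theta> t - \<theta>_star)"
        using convex_on_gradient_le[OF f(1) \<theta>_star_in iter(1)[OF t] f(2)[OF iter(1)[OF t]], of i]
        by (simp add: inner_diff_right)
      show "0 \<le> lam t $ i * w $ i" using iter(2)[OF t] w0[of i] by (simp add: prob_simplex_def)
    qed
    also have "\<dots> = (\<Sum>i\<in>UNIV. (lam t $ i * w $ i) *\<^sub>R gradient (f i) (\<theta> t)) \<bullet> (\<theta> t - \<theta>_star)"
      by (simp add: inner_sum_left)
    finally show "lagrangian f w (\<theta> t) lam_star - lagrangian f w \<theta>_star (lam t)
        \<le> (\<Sum>i\<in>UNIV. (lam t $ i * w $ i) *\<^sub>R gradient (f i) (\<theta> t)) \<bullet> (\<theta> t - \<theta>_star)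
          + - (\<chi> i. w $ i * f i (\<theta> t)) \<bullet> (lam t - lam_star)"
      by (simp add: lagrangian_eq_inner inner_diff_right)
  qed simp
  finally show ?thesis by (simp only: sum.distrib)
qed


section \<open>Stochastic gradients\<close>

lemma batch_history_space: "space (batch_history M Z batch n) = space M"
  unfolding batch_history_def by (subst space_measure_of) auto

lemma sets_batch_history:
  "sets (batch_history M Z batch n) = sigma_sets (space M)
     {batch s i -` A \<inter> space M | s i A. s \<in> {1..n} \<and> A \<in> sets (Z i)}"
  unfolding batch_history_def by (subst sets_measure_of) auto

lemma subalgebra_batch_history:
  assumes "\<And>t i. t \<in> {1..n} \<Longrightarrow> batch t i \<in> measurable M (Z i)"
  shows "subalgebra M (batch_history M Z batch n)"
  unfolding subalgebra_def batch_history_space sets_batch_history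
  using assms by (auto intro!: sets.sigma_sets_subset measurable_sets)

lemma batch_history_mono:
  assumes "m \<le> n"
  shows "subalgebra (batch_history M Z batch n) (batch_history M Z batch m)"
proof -
  have "{batch s i -` A \<inter> space M | s i A. s \<in> {1..m} \<and> A \<in> sets (Z i)}
      \<subseteq> {batch s i -` A \<inter> space M | s i A. s \<in> {1..n} \<and> A \<in> sets (Z i)}"
  proof clarify
    fix s i A assume "s \<in> {1..m}" "A \<in> sets (Z i)"
    then show "\<exists>s' i' A'. batch s i -` A \<inter> space M = batch s' i' -` A' \<inter> space M
        \<and> s' \<in> {1..n} \<and> A' \<in> sets (Z i')"
      using assms by (intro exI[of _ s] exI[of _ i] exI[of _ A]) auto
  qed
  then show ?thesis
    unfolding subalgebra_def batch_history_space sets_batch_history by (simp add: sigma_sets_mono')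
qed

lemma borel_measurable_vec_lambda:
  fixes h :: "'i::finite \<Rightarrow> 'a \<Rightarrow> real"
  assumes "\<And>i. h i \<in> borel_measurable M"
  shows "(\<lambda>\<omega>. \<chi> i. h i \<omega>) \<in> borel_measurable M"
proof -
  have "(\<lambda>\<omega>. \<Sum>i\<in>UNIV. h i \<omega> *\<^sub>R axis i (1::real)) \<in> borel_measurable M"
    using assms by measurable
  moreover have "(\<chi> i. h i \<omega>) = (\<Sum>i\<in>UNIV. h i \<omega> *\<^sub>R axis i (1::real))" for \<omega>
    by (simp add: vec_eq_iff axis_def if_distrib cong: if_cong)
  ultimately show ?thesis by simp
qed

lemma borel_measurable_vec_nth_comp:
  fixes h :: "'a \<Rightarrow> real ^ 'i"
  assumes "h \<in> borel_measurable M"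
  shows "(\<lambda>\<omega>. h \<omega> $ i) \<in> borel_measurable M"
  using assms by (rule measurable_compose) (intro borel_measurable_continuous_onI continuous_intros)

lemma integrable_vec_nth:
  fixes h :: "'a \<Rightarrow> real ^ 'i"
  assumes "integrable M h"
  shows "integrable M (\<lambda>\<omega>. h \<omega> $ i)"
  using integrable_inner_left[OF assms, of "axis i 1"] by (simp add: inner_axis)

lemma inner_le_card_mult:
  fixes a b :: "real ^ 'd"
  assumes "\<And>j. \<bar>a $ j\<bar> \<le> A" "\<And>j. \<bar>b $ j\<bar> \<le> B"
  shows "\<bar>a \<bullet> b\<bar> \<le> real CARD('d) * (A * B)"
proof -
  have "0 \<le> A" using assms(1) by (meson abs_ge_zero order_trans)
  then have "\<bar>a $ j * b $ j\<bar> \<le> A * B" for j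
    unfolding abs_mult using assms by (intro mult_mono) auto
  then have "\<bar>\<Sum>j\<in>UNIV. a $ j * b $ j\<bar> \<le> (\<Sum>j\<in>(UNIV::'d set). A * B)"
    by (intro order_trans[OF sum_abs] sum_mono)
  then show ?thesis by (simp add: inner_vec_def)
qed

text \<open>Two points of the simplex have l1 distance at most 2. Unlike in the coordinatewise bound
  for \<Theta>, the dimension does not appear.\<close>

lemma inner_simplex_diff_le:
  fixes a :: "real ^ 'm"
  assumes "\<And>i. \<bar>a $ i\<bar> \<le> A" "l \<in> prob_simplex" "v \<in> prob_simplex"
  shows "\<bar>a \<bullet> (l - v)\<bar> \<le> 2 * A"
proof -
  have "\<bar>a $ i * (l - v) $ i\<bar> \<le> A * (l $ i + v $ i)" for i
  proof -
    have "\<bar>(l - v) $ i\<bar> \<le> l $ i + v $ i" using assms(2,3) by (auto simp: prob_simplex_def abs_le_iff)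
    then show ?thesis unfolding abs_mult using assms(1)[of i] by (intro mult_mono) auto
  qed
  then have "\<bar>\<Sum>i\<in>UNIV. a $ i * (l - v) $ i\<bar> \<le> (\<Sum>i\<in>UNIV. A * (l $ i + v $ i))"
    by (intro order_trans[OF sum_abs] sum_mono)
  also have "\<dots> = 2 * A" using assms(2,3)
    by (simp add: sum.distrib prob_simplex_def flip: sum_distrib_left)
  finally show ?thesis by (simp add: inner_vec_def)
qed

lemma is_arg_max_iff_arg_min_uminus:
  fixes f :: "'a \<Rightarrow> real"
  shows "is_arg_max f P x \<longleftrightarrow> is_arg_min (\<lambda>x. - f x) P x"
  by (simp add: is_arg_min_linorder is_arg_max_linorder)

text \<open>Solves the Azuma-Hoeffding bound for the deviation at level \<gamma>, then passes from
  the sum over \<open>T\<close> rounds to the average.\<close>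

lemma ln_confidence:
  assumes "T \<ge> 1" "c > 0" "0 < \<gamma>" "\<gamma> < (1::real)"
  shows "exp (- (c * sqrt (2 * real T * ln (1 / \<gamma>)))\<^sup>2 / (2 * real T * c\<^sup>2)) = \<gamma>"
    and "1 / real T * (c * sqrt (2 * real T * ln (1 / \<gamma>))) = c * sqrt (2 / real T * ln (1 / \<gamma>))"
proof -
  have T: "real T > 0" and ln: "ln (1 / \<gamma>) \<ge> 0" using assms by auto
  have "(c * sqrt (2 * real T * ln (1 / \<gamma>)))\<^sup>2 = (2 * real T * c\<^sup>2) * ln (1 / \<gamma>)"
    using T ln by (simp add: power_mult_distrib)
  then show "exp (- (c * sqrt (2 * real T * ln (1 / \<gamma>)))\<^sup>2 / (2 * real T * c\<^sup>2)) = \<gamma>"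
    using T assms by (simp add: ln_div)
  have "2 * real T * ln (1 / \<gamma>) = (real T)\<^sup>2 * (2 / real T * ln (1 / \<gamma>))"
    using T by (simp add: power2_eq_square)
  then have "sqrt (2 * real T * ln (1 / \<gamma>)) = real T * sqrt (2 / real T * ln (1 / \<gamma>))"
    using T by (simp only: real_sqrt_mult) simp
  then show "1 / real T * (c * sqrt (2 * real T * ln (1 / \<gamma>))) = c * sqrt (2 / real T * ln (1 / \<gamma>))"
    using T by simp
qed

theorem theorem3p2:
  fixes \<Theta> \<Theta>0 :: "(real ^ 'd) set"
    and \<Delta>0 :: "(real ^ 'm) set"
    and f :: "'m \<Rightarrow> real ^ 'd \<Rightarrow> real"
    and w :: "real ^ 'm"
    and U L R :: real
    and T :: nat
    and M :: "'w measure"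
    and Z :: "'m \<Rightarrow> 'z measure"
    and batch :: "nat \<Rightarrow> 'm \<Rightarrow> 'w \<Rightarrow> 'z"
    and df_est :: "nat \<Rightarrow> 'm \<Rightarrow> 'w \<Rightarrow> real ^ 'd"
    and f_est :: "nat \<Rightarrow> 'm \<Rightarrow> 'w \<Rightarrow> real"
    and g_\<theta> :: "nat \<Rightarrow> 'w \<Rightarrow> real ^ 'd"
    and g_lam :: "nat \<Rightarrow> 'w \<Rightarrow> real ^ 'm"
    and \<psi>_\<theta> norm_\<theta> :: "real ^ 'd \<Rightarrow> real"
    and \<psi>_lam norm_lam :: "real ^ 'm \<Rightarrow> real"
    and \<mu>_\<theta> \<mu>_lam \<eta>_\<theta> \<eta>_lam :: real
    and D_\<theta> D_lam C_\<theta> C_lam :: real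
    and \<theta> :: "nat \<Rightarrow> 'w \<Rightarrow> real ^ 'd"
    and lam :: "nat \<Rightarrow> 'w \<Rightarrow> real ^ 'm"
    and \<theta>1 :: "real ^ 'd"
    and \<theta>_hat \<theta>_star :: "'w \<Rightarrow> real ^ 'd"
    and lam_star :: "'w \<Rightarrow> real ^ 'm"
    and \<gamma> :: real
  \<comment> \<open>problem\<close>
  assumes T: "T \<ge> 1"
    and \<Theta>: "\<Theta> \<noteq> {}" "closed \<Theta>" "convex \<Theta>"
    and w: "w \<in> prob_simplex"
    and f_diff: "\<And>i x. x \<in> \<Theta> \<Longrightarrow> f i differentiable (at x)"
    and f_nonneg: "\<And>i x. x \<in> \<Theta> \<Longrightarrow> 0 \<le> f i x"
    and consts_pos: "U > 0" "L > 0" "R > 0"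
    and f_convex: "\<And>i. convex_on \<Theta> (f i)"
    and f_le: "\<And>i x. x \<in> \<Theta> \<Longrightarrow> f i x \<le> U"
    and grad_f_le: "\<And>i x. x \<in> \<Theta> \<Longrightarrow> infnorm (gradient (f i) x) \<le> L"
    and \<Theta>_le: "\<And>x. x \<in> \<Theta> \<Longrightarrow> infnorm x \<le> R"
  \<comment> \<open>distance-generating functions\<close>
    and norm_\<theta>: "is_norm norm_\<theta>"
    and norm_lam: "is_norm norm_lam"
    and \<mu>_pos: "\<mu>_\<theta> > 0" "\<mu>_lam > 0"
    and dgf_\<theta>: "distance_generating \<Theta> \<Theta>0 \<psi>_\<theta>"
    and dgf_lam: "distance_generating prob_simplex \<Delta>0 \<psi>_lam"
    and prox_\<theta>: "prox_closed \<Theta> \<Theta>0 \<psi>_\<theta>"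
    and prox_lam: "prox_closed prob_simplex \<Delta>0 \<psi>_lam"
    and sc_\<theta>: "strongly_convex_on \<Theta> norm_\<theta> \<mu>_\<theta> \<psi>_\<theta>"
    and sc_lam: "strongly_convex_on prob_simplex norm_lam \<mu>_lam \<psi>_lam"
  \<comment> \<open>stochastic gradients\<close>
    and M: "prob_space M"
    and batch_meas: "\<And>t i. t \<in> {1..T} \<Longrightarrow> batch t i \<in> measurable M (Z i)"
    and df_est_meas: "\<And>t i. t \<in> {1..T} \<Longrightarrow>
          df_est t i \<in> borel_measurable (batch_history M Z batch t)"
    and f_est_meas: "\<And>t i. t \<in> {1..T} \<Longrightarrow>
          f_est t i \<in> borel_measurable (batch_history M Z batch t)"
    and df_est_int: "\<And>t i. t \<in> {1..T} \<Longrightarrow> integrable M (df_est t i)"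
    and f_est_int: "\<And>t i. t \<in> {1..T} \<Longrightarrow> integrable M (f_est t i)"
    and df_est_unbiased: "\<And>t i j. t \<in> {1..T} \<Longrightarrow> AE \<omega> in M.
          real_cond_exp M (batch_history M Z batch (t - 1)) (\<lambda>\<omega>. df_est t i \<omega> $ j) \<omega>
            = gradient (f i) (\<theta> t \<omega>) $ j"
    and f_est_unbiased: "\<And>t i. t \<in> {1..T} \<Longrightarrow> AE \<omega> in M.
          real_cond_exp M (batch_history M Z batch (t - 1)) (f_est t i) \<omega> = f i (\<theta> t \<omega>)"
    and g_\<theta>: "\<And>t \<omega>. g_\<theta> t \<omega> = (\<Sum>i\<in>UNIV. (lam t \<omega> $ i * w $ i) *\<^sub>R df_est t i \<omega>)"
    and g_lam: "\<And>t \<omega>. g_lam t \<omega> = (\<chi> i. w $ i * f_est t i \<omega>)"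
    and g_\<theta>_le: "\<And>t. t \<in> {1..T} \<Longrightarrow> AE \<omega> in M. infnorm (g_\<theta> t \<omega>) \<le> L"
    and g_lam_le: "\<And>t. t \<in> {1..T} \<Longrightarrow> AE \<omega> in M. infnorm (g_lam t \<omega>) \<le> U"
  \<comment> \<open>iterates\<close>
    and \<theta>1: "\<theta>1 \<in> \<Theta>0" "\<And>\<omega>. \<omega> \<in> space M \<Longrightarrow> \<theta> 1 \<omega> = \<theta>1"
    and lam1: "(\<chi> i. 1 / real CARD('m)) \<in> \<Delta>0"
          "\<And>\<omega>. \<omega> \<in> space M \<Longrightarrow> lam 1 \<omega> = (\<chi> i. 1 / real CARD('m))"
    and \<theta>_step: "\<And>t \<omega>. t \<in> {1..T} \<Longrightarrow> \<omega> \<in> space M \<Longrightarrow>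
          is_arg_min (\<lambda>x. g_\<theta> t \<omega> \<bullet> x + 1 / \<eta>_\<theta> * bregman \<psi>_\<theta> x (\<theta> t \<omega>))
            (\<lambda>x. x \<in> \<Theta>) (\<theta> (t + 1) \<omega>)"
    and lam_step: "\<And>t \<omega>. t \<in> {1..T} \<Longrightarrow> \<omega> \<in> space M \<Longrightarrow>
          is_arg_max (\<lambda>l. g_lam t \<omega> \<bullet> l - 1 / \<eta>_lam * bregman \<psi>_lam l (lam t \<omega>))
            (\<lambda>l. l \<in> prob_simplex) (lam (t + 1) \<omega>)"
  \<comment> \<open>output\<close>
    and \<theta>_hat: "\<theta>_hat = (\<lambda>\<omega>. uniform_average (\<lambda>t. \<theta> t \<omega>) T) \<or>
                \<theta>_hat = (\<lambda>\<omega>. adaptive_average f (\<lambda>t. \<theta> t \<omega>) T)"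
  \<comment> \<open>constants\<close>
    and DC_pos: "D_\<theta> > 0" "D_lam > 0" "C_\<theta> > 0" "C_lam > 0"
    and \<theta>_star: "\<And>\<omega>. \<omega> \<in> space M \<Longrightarrow>
          is_arg_min (\<lambda>x. lagrangian f w x (uniform_average (\<lambda>t. lam t \<omega>) T))
            (\<lambda>x. x \<in> \<Theta>) (\<theta>_star \<omega>)"
    and lam_star: "\<And>\<omega>. \<omega> \<in> space M \<Longrightarrow>
          is_arg_max (\<lambda>l. lagrangian f w (\<theta>_hat \<omega>) l) (\<lambda>l. l \<in> prob_simplex) (lam_star \<omega>)"
    and D_\<theta>: "AE \<omega> in M. bregman \<psi>_\<theta> (\<theta>_star \<omega>) (\<theta> 1 \<omega>) \<le> D_\<theta>"
    and D_lam: "AE \<omega> in M. bregman \<psi>_lam (lam_star \<omega>) (lam 1 \<omega>) \<le> D_lam"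
    and C_\<theta>_grad: "\<And>t. t \<in> {1..T} \<Longrightarrow> AE \<omega> in M.
          (dual_norm norm_\<theta> (gradient (\<lambda>x. lagrangian f w x (lam t \<omega>)) (\<theta> t \<omega>)))\<^sup>2 \<le> C_\<theta> * L\<^sup>2"
    and C_\<theta>_est: "\<And>t. t \<in> {1..T} \<Longrightarrow> AE \<omega> in M.
          (dual_norm norm_\<theta> (g_\<theta> t \<omega>))\<^sup>2 \<le> C_\<theta> * L\<^sup>2"
    and C_lam_grad: "\<And>t. t \<in> {1..T} \<Longrightarrow> AE \<omega> in M.
          (dual_norm norm_lam (gradient (\<lambda>l. lagrangian f w (\<theta> t \<omega>) l) (lam t \<omega>)))\<^sup>2 \<le> C_lam * U\<^sup>2"
    and C_lam_est: "\<And>t. t \<in> {1..T} \<Longrightarrow> AE \<omega> in M.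
          (dual_norm norm_lam (g_lam t \<omega>))\<^sup>2 \<le> C_lam * U\<^sup>2"
  \<comment> \<open>step sizes and confidence level\<close>
    and \<eta>_\<theta>: "\<eta>_\<theta> = sqrt (4 * \<mu>_\<theta> * D_\<theta> / (5 * real T * C_\<theta> * L\<^sup>2))"
    and \<eta>_lam: "\<eta>_lam = sqrt (4 * \<mu>_lam * D_lam / (5 * real T * C_lam * U\<^sup>2))"
    and \<gamma>: "0 < \<gamma>" "\<gamma> < 1"
  shows "measure M {\<omega> \<in> space M.
           TCH f w (\<theta>_hat \<omega>) - (INF x\<in>\<Theta>. TCH f w x)
             \<le> sqrt (20 * D_\<theta> * C_\<theta> * L\<^sup>2 / (\<mu>_\<theta> * real T))
               + sqrt (20 * D_lam * C_lam * U\<^sup>2 / (\<mu>_lam * real T))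
               + 4 * (real CARD('d) * R * L + U) * sqrt (2 / real T * ln (1 / \<gamma>))}
         \<ge> 1 - \<gamma>"
proof -
  interpret prob_space M by (rule M)
  \<comment> \<open>Rounds are counted from \<open>0\<close> below: \<open>\<theta> (Suc n)\<close> and \<open>lam (Suc n)\<close> are \<open>F n\<close>-measurable.\<close>
  define F where "F = batch_history M Z batch"
  have F_sub: "subalgebra M (F n)" if "n \<le> T" for n
    unfolding F_def using that by (intro subalgebra_batch_history batch_meas) auto
  have F_mono: "subalgebra (F (Suc n)) (F n)" for n
    unfolding F_def by (intro batch_history_mono) simp
  have F_space: "space (F n) = space M" for n by (simp add: F_def batch_history_space)
  have Suc_in: "Suc n \<in> {1..T}" if "n < T" for n using that by auto

  \<comment> \<open>Step sizes, compactness and feasibility\<close>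
  have T0: "real T > 0" using T by simp
  have \<eta>_\<theta>': "\<eta>_\<theta> = sqrt (4 * \<mu>_\<theta> * D_\<theta> / (5 * real T * (C_\<theta> * L\<^sup>2)))"
    and \<eta>_lam': "\<eta>_lam = sqrt (4 * \<mu>_lam * D_lam / (5 * real T * (C_lam * U\<^sup>2)))"
    using \<eta>_\<theta> \<eta>_lam by (simp_all add: mult.assoc)
  have CL: "C_\<theta> * L\<^sup>2 > 0" "C_lam * U\<^sup>2 > 0" using DC_pos consts_pos by auto
  have \<eta>_pos: "\<eta>_\<theta> > 0" "\<eta>_lam > 0"
    unfolding \<eta>_\<theta>' \<eta>_lam' using CL DC_pos \<mu>_pos T0 by auto
  \<comment> \<open>Compactness is what gives the auxiliary steps their minimizers, as no hypothesis
    provides them.\<close>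
  have compact_\<Theta>: "compact \<Theta>"
  proof -
    have "norm x \<le> sqrt (real DIM(real ^ 'd)) * R" if "x \<in> \<Theta>" for x
      by (rule order_trans[OF norm_le_infnorm mult_left_mono[OF \<Theta>_le[OF that]]]) simp
    then show ?thesis using \<Theta>(2) by (auto simp: compact_eq_bounded_closed bounded_iff)
  qed
  have w01: "0 \<le> w $ i" "w $ i \<le> 1" for i
    using w prob_simplex_le_1[OF w] by (auto simp: prob_simplex_def)

  \<comment> \<open>Ascent along \<open>g_lam\<close> is descent along its negative, so both players
    fall under the same lemmas.\<close>
  have lam_step': "is_arg_min (\<lambda>l. (- g_lam (Suc n) \<omega>) \<bullet> l + 1 / \<eta>_lam * bregman \<psi>_lam l (lam (Suc n) \<omega>))
      (\<lambda>l. l \<in> prob_simplex) (lam (Suc (Suc n)) \<omega>)" if "n < T" "\<omega> \<in> space M" for n \<omega>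
    using lam_step[OF Suc_in[OF that(1)] that(2)] by (simp add: is_arg_max_iff_arg_min_uminus algebra_simps)
  have \<theta>_step': "is_arg_min (\<lambda>x. g_\<theta> (Suc n) \<omega> \<bullet> x + 1 / \<eta>_\<theta> * bregman \<psi>_\<theta> x (\<theta> (Suc n) \<omega>))
      (\<lambda>x. x \<in> \<Theta>) (\<theta> (Suc (Suc n)) \<omega>)" if "n < T" "\<omega> \<in> space M" for n \<omega>
    using \<theta>_step[OF Suc_in[OF that(1)] that(2)] by simp
  have lam_in: "lam (Suc n) \<omega> \<in> prob_simplex" if "n \<le> T" "\<omega> \<in> space M" for n \<omega>
    using omd_iterates_in[where x = "\<lambda>n. lam (Suc n) \<omega>" and g = "\<lambda>n. - g_lam (Suc n) \<omega>",
        OF prox_lam \<eta>_pos(2) _ lam_step' that(1)] lam1 that(2) distance_generatingD(1)[OF dgf_lam]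
    by auto
  have \<theta>_in: "\<theta> (Suc n) \<omega> \<in> \<Theta>" if "n \<le> T" "\<omega> \<in> space M" for n \<omega>
    using omd_iterates_in[where x = "\<lambda>n. \<theta> (Suc n) \<omega>" and g = "\<lambda>n. g_\<theta> (Suc n) \<omega>",
        OF prox_\<theta> \<eta>_pos(1) _ \<theta>_step' that(1)] \<theta>1 that(2) distance_generatingD(1)[OF dgf_\<theta>]
    by auto
  have lw: "0 \<le> lam (Suc n) \<omega> $ i * w $ i" "lam (Suc n) \<omega> $ i * w $ i \<le> lam (Suc n) \<omega> $ i"
    "lam (Suc n) \<omega> $ i \<le> 1" "0 \<le> lam (Suc n) \<omega> $ i" if "n \<le> T" "\<omega> \<in> space M" for n \<omega> i
    using lam_in[OF that] prob_simplex_le_1[OF lam_in[OF that]] w01[of i]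
    by (auto simp: prob_simplex_def mult_left_le)

  \<comment> \<open>Adaptedness of the iterates\<close>
  have g_lam_meas: "g_lam (Suc n) \<in> borel_measurable (F (Suc n))" if "n < T" for n
  proof -
    have [measurable]: "f_est (Suc n) i \<in> borel_measurable (F (Suc n))" for i
      using f_est_meas[OF Suc_in[OF that]] by (simp add: F_def)
    have "(\<lambda>\<omega>. \<chi> i. w $ i * f_est (Suc n) i \<omega>) \<in> borel_measurable (F (Suc n))"
      by (rule borel_measurable_vec_lambda) measurable
    moreover have "g_lam (Suc n) = (\<lambda>\<omega>. \<chi> i. w $ i * f_est (Suc n) i \<omega>)" by (simp add: fun_eq_iff g_lam)
    ultimately show ?thesis by simp
  qed
  \<comment> \<open>The weights come before \<open>\<theta>\<close>: \<open>g_lam\<close> is built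
    from the estimates alone, whereas \<open>g_\<theta>\<close> also contains
    \<open>lam\<close>.\<close>
  have lam_meas: "lam (Suc n) \<in> borel_measurable (F n)" if "n \<le> T" for n
    by (rule omd_measurable[where x = "\<lambda>n. lam (Suc n)" and F = F and g = "\<lambda>n \<omega>. - g_lam (Suc n) \<omega>"
        and \<Omega> = "space M", OF convex_prob_simplex compact_prob_simplex dgf_lam prox_lam sc_lam
          norm_lam \<mu>_pos(2) \<eta>_pos(2) lam1(1) _ lam_step' F_space F_mono _ that])
      (use lam1(2) g_lam_meas in auto)
  have lam_nth_meas: "(\<lambda>\<omega>. lam (Suc n) \<omega> $ i) \<in> borel_measurable (F n)" if "n \<le> T" for n i
    by (rule borel_measurable_vec_nth_comp[OF lam_meas[OF that]])
  have g_\<theta>_meas: "g_\<theta> (Suc n) \<in> borel_measurable (F (Suc n))" if "n < T" for n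
  proof -
    have [measurable]: "df_est (Suc n) i \<in> borel_measurable (F (Suc n))"
      "(\<lambda>\<omega>. lam (Suc n) \<omega> $ i) \<in> borel_measurable (F (Suc n))" for i
      using df_est_meas[OF Suc_in[OF that]] measurable_from_subalg[OF F_mono lam_nth_meas] that
      by (auto simp: F_def)
    have "(\<lambda>\<omega>. \<Sum>i\<in>UNIV. (lam (Suc n) \<omega> $ i * w $ i) *\<^sub>R df_est (Suc n) i \<omega>) \<in> borel_measurable (F (Suc n))"
      by measurable
    moreover have "g_\<theta> (Suc n) = (\<lambda>\<omega>. \<Sum>i\<in>UNIV. (lam (Suc n) \<omega> $ i * w $ i) *\<^sub>R df_est (Suc n) i \<omega>)"
      by (simp add: fun_eq_iff g_\<theta>)
    ultimately show ?thesis by simp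
  qed
  have \<theta>_meas: "\<theta> (Suc n) \<in> borel_measurable (F n)" if "n \<le> T" for n
    by (rule omd_measurable[where x = "\<lambda>n. \<theta> (Suc n)" and F = F and g = "\<lambda>n. g_\<theta> (Suc n)"
        and \<Omega> = "space M", OF \<Theta>(3) compact_\<Theta> dgf_\<theta> prox_\<theta> sc_\<theta>
          norm_\<theta> \<mu>_pos(1) \<eta>_pos(1) \<theta>1(1) _ \<theta>_step' F_space F_mono _ that])
      (use \<theta>1(2) g_\<theta>_meas in auto)

  \<comment> \<open>\<open>E\<close> and \<open>e\<close> are versions of \<open>\<nabla>f\<^sub>i(\<theta>\<^sub>t)\<close> and \<open>f\<^sub>i(\<theta>\<^sub>t)\<close> that are measurable by construction, so no
    measurability of the gradient of \<open>f\<^sub>i\<close> is needed.\<close>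
  define E where "E = (\<lambda>n i j. real_cond_exp M (F n) (\<lambda>\<omega>. df_est (Suc n) i \<omega> $ j))"
  define e where "e = (\<lambda>n i. real_cond_exp M (F n) (f_est (Suc n) i))"
  define G where "G = (\<lambda>n \<omega>. \<Sum>i\<in>UNIV. (lam (Suc n) \<omega> $ i * w $ i) *\<^sub>R (\<chi> j. E n i j \<omega>))"
  define H where "H = (\<lambda>n \<omega>. - (\<chi> i. w $ i * e n i \<omega>))"
  have G_meas: "G n \<in> borel_measurable (F n)" if "n < T" for n
  proof -
    have [measurable]: "(\<lambda>\<omega>. \<chi> j. E n i j \<omega>) \<in> borel_measurable (F n)"
      "(\<lambda>\<omega>. lam (Suc n) \<omega> $ i) \<in> borel_measurable (F n)" for i
      using lam_nth_meas that by (auto simp: E_def intro!: borel_measurable_vec_lambda)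
    show ?thesis unfolding G_def by measurable
  qed
  have H_meas: "H n \<in> borel_measurable (F n)" for n
  proof -
    have [measurable]: "(\<lambda>\<omega>. \<chi> i. w $ i * e n i \<omega>) \<in> borel_measurable (F n)"
      by (rule borel_measurable_vec_lambda) (simp add: e_def)
    show ?thesis unfolding H_def by measurable
  qed
  have AE_G: "AE \<omega> in M. G n \<omega> = (\<Sum>i\<in>UNIV. (lam (Suc n) \<omega> $ i * w $ i) *\<^sub>R gradient (f i) (\<theta> (Suc n) \<omega>))"
    if "n < T" for n
  proof -
    have "AE \<omega> in M. \<forall>i j. E n i j \<omega> = gradient (f i) (\<theta> (Suc n) \<omega>) $ j"
      unfolding AE_all_countable E_def F_def using df_est_unbiased[OF Suc_in[OF that]] by simp
    then show ?thesis by eventually_elim (simp add: G_def)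
  qed
  have AE_H: "AE \<omega> in M. H n \<omega> = - (\<chi> i. w $ i * f i (\<theta> (Suc n) \<omega>))" if "n < T" for n
  proof -
    have "AE \<omega> in M. \<forall>i. e n i \<omega> = f i (\<theta> (Suc n) \<omega>)"
      unfolding AE_all_countable e_def F_def using f_est_unbiased[OF Suc_in[OF that]] by simp
    then show ?thesis by eventually_elim (simp add: H_def)
  qed
  have C_G: "AE \<omega> in M. (dual_norm norm_\<theta> (G n \<omega>))\<^sup>2 \<le> C_\<theta> * L\<^sup>2" if "n < T" for n
    using AE_G[OF that] C_\<theta>_grad[OF Suc_in[OF that]] AE_space
  proof eventually_elim
    case (elim \<omega>)
    have "f i differentiable (at (\<theta> (Suc n) \<omega>))" for i
      using \<theta>_in[of n \<omega>] that elim(3) by (intro f_diff) auto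
    then show ?case using elim(1,2) by (simp add: gradient_lagrangian_theta)
  qed
  \<comment> \<open>\<open>H\<close> carries the sign of the ascent, which the dual norm does not
    see.\<close>
  have C_H: "AE \<omega> in M. (dual_norm norm_lam (H n \<omega>))\<^sup>2 \<le> C_lam * U\<^sup>2" if "n < T" for n
    using AE_H[OF that] C_lam_grad[OF Suc_in[OF that]]
    by eventually_elim (simp add: gradient_lagrangian_lam dual_norm_minus[OF norm_lam])

  \<comment> \<open>Regret against arbitrary comparison points\<close>
  obtain u where u: "\<And>n. n \<le> T \<Longrightarrow> u n \<in> borel_measurable (F n)"
    "\<And>n \<omega>. n \<le> T \<Longrightarrow> \<omega> \<in> space M \<Longrightarrow> u n \<omega> \<in> \<Theta>"
    and regret_\<theta>: "AE \<omega> in M. \<forall>z\<in>\<Theta>. bregman \<psi>_\<theta> z \<theta>1 \<le> D_\<theta> \<longrightarrow>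
      (\<Sum>n<T. G n \<omega> \<bullet> (\<theta> (Suc n) \<omega> - z)) \<le> real T * sqrt (20 * D_\<theta> * (C_\<theta> * L\<^sup>2) / (\<mu>_\<theta> * real T))
        + (\<Sum>n<T. (G n \<omega> - g_\<theta> (Suc n) \<omega>) \<bullet> (\<theta> (Suc n) \<omega> - u n \<omega>))"
    by (rule omd_stochastic[where x = "\<lambda>n. \<theta> (Suc n)" and F = F and g = "\<lambda>n. g_\<theta> (Suc n)" and G = G
        and M = M and T = T and C = "C_\<theta> * L\<^sup>2", OF \<Theta>(3) compact_\<Theta> dgf_\<theta> prox_\<theta> sc_\<theta> norm_\<theta>
          \<mu>_pos(1) DC_pos(1) CL(1) T \<eta>_\<theta>' \<theta>1(1) _ \<theta>_step' F_sub F_mono g_\<theta>_meas G_meas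
          C_\<theta>_est[OF Suc_in] C_G]) (use \<theta>1(2) in auto)
  obtain v where v: "\<And>n. n \<le> T \<Longrightarrow> v n \<in> borel_measurable (F n)"
    "\<And>n \<omega>. n \<le> T \<Longrightarrow> \<omega> \<in> space M \<Longrightarrow> v n \<omega> \<in> prob_simplex"
    and regret_lam: "AE \<omega> in M. \<forall>z\<in>prob_simplex. bregman \<psi>_lam z (\<chi> i. 1 / real CARD('m)) \<le> D_lam \<longrightarrow>
      (\<Sum>n<T. H n \<omega> \<bullet> (lam (Suc n) \<omega> - z)) \<le> real T * sqrt (20 * D_lam * (C_lam * U\<^sup>2) / (\<mu>_lam * real T))
        + (\<Sum>n<T. (H n \<omega> - - g_lam (Suc n) \<omega>) \<bullet> (lam (Suc n) \<omega> - v n \<omega>))"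
  proof (rule omd_stochastic[where x = "\<lambda>n. lam (Suc n)" and F = F and g = "\<lambda>n \<omega>. - g_lam (Suc n) \<omega>"
        and G = H and M = M and T = T and C = "C_lam * U\<^sup>2", OF convex_prob_simplex compact_prob_simplex
          dgf_lam prox_lam sc_lam norm_lam \<mu>_pos(2) DC_pos(2) CL(2) T \<eta>_lam' lam1(1) _ lam_step'
          F_sub F_mono _ H_meas _ C_H])
    show "(\<lambda>\<omega>. - g_lam (Suc n) \<omega>) \<in> borel_measurable (F (Suc n))" if "n < T" for n
      using g_lam_meas[OF that] by measurable
    show "AE \<omega> in M. (dual_norm norm_lam (- g_lam (Suc n) \<omega>))\<^sup>2 \<le> C_lam * U\<^sup>2" if "n < T" for n
      using C_lam_est[OF Suc_in[OF that]] by (simp add: dual_norm_minus[OF norm_lam])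
  qed (use lam1(2) in auto)

  \<comment> \<open>The joint martingale difference of both players\<close>
  define X where "X = (\<lambda>n \<omega>. (G n \<omega> - g_\<theta> (Suc n) \<omega>) \<bullet> (\<theta> (Suc n) \<omega> - u n \<omega>)
      + (H n \<omega> - - g_lam (Suc n) \<omega>) \<bullet> (lam (Suc n) \<omega> - v n \<omega>))"
  \<comment> \<open>For \<open>\<theta>\<close>, noise at most \<open>2 * L\<close> meets a
    displacement of at most \<open>2 * R\<close> in each coordinate; for the weights, noise at most
    \<open>2 * U\<close> in each coordinate meets an l1 distance of at most 2.\<close>
  define c where "c = 4 * (real CARD('d) * R * L + U)"
  have c_pos: "c > 0" using consts_pos by (simp add: c_def add_pos_pos)
  have \<Theta>_nth: "\<bar>x $ j\<bar> \<le> R" if "x \<in> \<Theta>" for x j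
    using component_le_infnorm_cart[of x j] \<Theta>_le[OF that] by linarith

  interpret bounded_martingale_difference M F X c T
  proof (unfold_locales)
    fix n assume n: "n < T"
    have [measurable]: "G n \<in> borel_measurable (F (Suc n))" "H n \<in> borel_measurable (F (Suc n))"
      "g_\<theta> (Suc n) \<in> borel_measurable (F (Suc n))" "g_lam (Suc n) \<in> borel_measurable (F (Suc n))"
      "\<theta> (Suc n) \<in> borel_measurable (F (Suc n))" "lam (Suc n) \<in> borel_measurable (F (Suc n))"
      "u n \<in> borel_measurable (F (Suc n))" "v n \<in> borel_measurable (F (Suc n))"
      using n G_meas H_meas g_\<theta>_meas g_lam_meas \<theta>_meas lam_meas u(1) v(1)
      by (auto intro: measurable_from_subalg[OF F_mono])
    show "X n \<in> borel_measurable (F (Suc n))" unfolding X_def by measurable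
  next
    fix n assume n: "n < T"
    show "AE \<omega> in M. \<bar>X n \<omega>\<bar> \<le> c"
      using AE_G[OF n] AE_H[OF n] g_\<theta>_le[OF Suc_in[OF n]] g_lam_le[OF Suc_in[OF n]] AE_space
    proof eventually_elim
      case (elim \<omega>)
      have in\<Theta>: "\<theta> (Suc n) \<omega> \<in> \<Theta>" "u n \<omega> \<in> \<Theta>" using \<theta>_in u(2) n elim(5) by auto
      have in\<Delta>: "lam (Suc n) \<omega> \<in> prob_simplex" "v n \<omega> \<in> prob_simplex" using lam_in v(2) n elim(5) by auto
      have GL: "\<bar>G n \<omega> $ j\<bar> \<le> L" for j
      proof -
        have grad: "\<bar>gradient (f i) (\<theta> (Suc n) \<omega>) $ j\<bar> \<le> L" for i
          using component_le_infnorm_cart[of "gradient (f i) (\<theta> (Suc n) \<omega>)" j] grad_f_le[OF in\<Theta>(1), of i]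
          by linarith
        have "\<bar>G n \<omega> $ j\<bar> \<le> (\<Sum>i\<in>UNIV. \<bar>lam (Suc n) \<omega> $ i * w $ i * gradient (f i) (\<theta> (Suc n) \<omega>) $ j\<bar>)"
          using elim(1) by (simp add: sum_abs)
        also have "\<dots> \<le> (\<Sum>i\<in>UNIV. lam (Suc n) \<omega> $ i * L)"
          unfolding abs_mult[of "_ * _"]
          using lw[of n \<omega>] n elim(5) grad by (intro sum_mono mult_mono) auto
        also have "\<dots> = L" using in\<Delta>(1) by (simp add: prob_simplex_def flip: sum_distrib_right)
        finally show ?thesis .
      qed
      have gL: "\<bar>g_\<theta> (Suc n) \<omega> $ j\<bar> \<le> L" for j
        using component_le_infnorm_cart[of "g_\<theta> (Suc n) \<omega>" j] elim(3) by linarith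
      have "\<bar>(G n \<omega> - g_\<theta> (Suc n) \<omega>) $ j\<bar> \<le> 2 * L" for j
        unfolding vector_minus_component
        using abs_triangle_ineq4[of "G n \<omega> $ j" "g_\<theta> (Suc n) \<omega> $ j"] GL[of j] gL[of j] by linarith
      moreover have "\<bar>(\<theta> (Suc n) \<omega> - u n \<omega>) $ j\<bar> \<le> 2 * R" for j
        using abs_triangle_ineq4[of "\<theta> (Suc n) \<omega> $ j" "u n \<omega> $ j"] \<Theta>_nth[OF in\<Theta>(1), of j] \<Theta>_nth[OF in\<Theta>(2), of j]
        by simp
      ultimately have 1: "\<bar>(G n \<omega> - g_\<theta> (Suc n) \<omega>) \<bullet> (\<theta> (Suc n) \<omega> - u n \<omega>)\<bar>
          \<le> real CARD('d) * (2 * L * (2 * R))"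
        by (rule inner_le_card_mult)
      have HU: "\<bar>H n \<omega> $ i\<bar> \<le> U" for i
        using elim(2) f_le[OF in\<Theta>(1), of i] f_nonneg[OF in\<Theta>(1), of i] w01[of i]
          mult_mono[of "w $ i" 1 "f i (\<theta> (Suc n) \<omega>)" U] by simp
      have gU: "\<bar>g_lam (Suc n) \<omega> $ i\<bar> \<le> U" for i
        using component_le_infnorm_cart[of "g_lam (Suc n) \<omega>" i] elim(4) by linarith
      have "\<bar>(H n \<omega> - - g_lam (Suc n) \<omega>) $ i\<bar> \<le> 2 * U" for i
        unfolding diff_minus_eq_add vector_add_component
        using abs_triangle_ineq[of "H n \<omega> $ i" "g_lam (Suc n) \<omega> $ i"] HU[of i] gU[of i] by linarith
      then have 2: "\<bar>(H n \<omega> - - g_lam (Suc n) \<omega>) \<bullet> (lam (Suc n) \<omega> - v n \<omega>)\<bar> \<le> 2 * (2 * U)"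
        using in\<Delta> by (intro inner_simplex_diff_le)
      show ?case using 1 2 by (simp add: X_def c_def algebra_simps)
    qed
  next
    fix n assume n: "n < T"
    interpret S: finite_measure_subalgebra M "F n" using F_sub[of n] n by unfold_locales auto
    \<comment> \<open>Expanded over pairs of an objective and a coordinate, every term is a
      predictable scalar weight times the error of one scalar estimate, as real-valued conditional
      expectations require.\<close>
    have 1: "(G n \<omega> - g_\<theta> (Suc n) \<omega>) \<bullet> (\<theta> (Suc n) \<omega> - u n \<omega>)
        = (\<Sum>(i, j)\<in>UNIV. (lam (Suc n) \<omega> $ i * w $ i * (\<theta> (Suc n) \<omega> - u n \<omega>) $ j)
            * (E n i j \<omega> - df_est (Suc n) i \<omega> $ j))" for \<omega>
    proof -
      have "G n \<omega> - g_\<theta> (Suc n) \<omega> = (\<Sum>i\<in>UNIV. (lam (Suc n) \<omega> $ i * w $ i) *\<^sub>R ((\<chi> j. E n i j \<omega>) - df_est (Suc n) i \<omega>))"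
        by (simp add: G_def g_\<theta> scaleR_diff_right sum_subtractf)
      then have "(G n \<omega> - g_\<theta> (Suc n) \<omega>) \<bullet> (\<theta> (Suc n) \<omega> - u n \<omega>) = (\<Sum>i\<in>UNIV.
          lam (Suc n) \<omega> $ i * w $ i * (((\<chi> j. E n i j \<omega>) - df_est (Suc n) i \<omega>) \<bullet> (\<theta> (Suc n) \<omega> - u n \<omega>)))"
        by (simp only: inner_sum_left inner_scaleR_left)
      also have "\<dots> = (\<Sum>i\<in>UNIV. \<Sum>j\<in>UNIV. (lam (Suc n) \<omega> $ i * w $ i * (\<theta> (Suc n) \<omega> - u n \<omega>) $ j)
          * (E n i j \<omega> - df_est (Suc n) i \<omega> $ j))"
        by (simp add: inner_vec_def sum_distrib_left mult_ac)
      finally show ?thesis by (simp only: sum.cartesian_product UNIV_Times_UNIV)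
    qed
    \<comment> \<open>The minus sign in \<open>H\<close> is absorbed by exchanging
      \<open>lam\<close> and \<open>v\<close>.\<close>
    have 2: "(H n \<omega> - - g_lam (Suc n) \<omega>) \<bullet> (lam (Suc n) \<omega> - v n \<omega>)
        = (\<Sum>i\<in>UNIV. (w $ i * (v n \<omega> - lam (Suc n) \<omega>) $ i) * (e n i \<omega> - f_est (Suc n) i \<omega>))" for \<omega>
      by (simp add: H_def g_lam inner_vec_def algebra_simps)
    let ?V = "\<lambda>(i, j) \<omega>. lam (Suc n) \<omega> $ i * w $ i * (\<theta> (Suc n) \<omega> - u n \<omega>) $ j"
    let ?Z = "\<lambda>(i, j) \<omega>. df_est (Suc n) i \<omega> $ j"
    let ?V' = "\<lambda>i \<omega>. w $ i * (v n \<omega> - lam (Suc n) \<omega>) $ i"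
    have V: "?V p \<in> borel_measurable (F n)" for p
    proof (cases p)
      case (Pair i j)
      have [measurable]: "(\<lambda>\<omega>. lam (Suc n) \<omega> $ i) \<in> borel_measurable (F n)"
        "(\<lambda>\<omega>. \<theta> (Suc n) \<omega> $ j) \<in> borel_measurable (F n)" "(\<lambda>\<omega>. u n \<omega> $ j) \<in> borel_measurable (F n)"
        using n by (auto intro!: borel_measurable_vec_nth_comp lam_meas \<theta>_meas u(1))
      show ?thesis unfolding Pair by (simp add: vector_minus_component)
    qed
    have V': "?V' i \<in> borel_measurable (F n)" for i
    proof -
      have [measurable]: "(\<lambda>\<omega>. lam (Suc n) \<omega> $ i) \<in> borel_measurable (F n)"
        "(\<lambda>\<omega>. v n \<omega> $ i) \<in> borel_measurable (F n)"
        using n by (auto intro!: borel_measurable_vec_nth_comp lam_meas v(1))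
      show ?thesis by (simp add: vector_minus_component)
    qed
    have V_le: "\<bar>?V p \<omega>\<bar> \<le> 1 * (2 * R)" if "\<omega> \<in> space M" for p \<omega>
    proof (cases p)
      case (Pair i j)
      have "\<bar>lam (Suc n) \<omega> $ i * w $ i\<bar> \<le> 1" using lw[of n \<omega> i] n that by linarith
      moreover have "\<bar>(\<theta> (Suc n) \<omega> - u n \<omega>) $ j\<bar> \<le> 2 * R"
        using \<Theta>_nth[OF \<theta>_in[of n \<omega>], of j] \<Theta>_nth[OF u(2)[of n \<omega>], of j] n that by (simp add: abs_le_iff)
      ultimately show ?thesis unfolding Pair prod.case abs_mult[of "_ * _"] by (intro mult_mono) auto
    qed
    have V'_le: "\<bar>?V' i \<omega>\<bar> \<le> 1 * 1" if "\<omega> \<in> space M" for i \<omega>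
    proof -
      have v01: "0 \<le> v n \<omega> $ i" "v n \<omega> $ i \<le> 1"
        using v(2)[of n \<omega>] n that prob_simplex_le_1[of "v n \<omega>" i] by (auto simp: prob_simplex_def)
      have "\<bar>(v n \<omega> - lam (Suc n) \<omega>) $ i\<bar> \<le> 1"
        unfolding vector_minus_component
        using v01 lw(3,4)[of n \<omega> i] n that by linarith
      then show ?thesis unfolding abs_mult using w01[of i] by (intro mult_mono) auto
    qed
    have Z: "integrable M (?Z p)" for p
      using df_est_int[OF Suc_in[OF n]] by (cases p) (simp add: integrable_vec_nth)
    note err1 = S.real_cond_exp_weighted_error[where I = UNIV and V = ?V and Z = ?Z, OF _ V V_le Z]
    note err2 = S.real_cond_exp_weighted_error[where I = UNIV and V = ?V' and Z = "f_est (Suc n)",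
        OF _ V' V'_le f_est_int[OF Suc_in[OF n]]]
    let ?X1 = "\<lambda>\<omega>. \<Sum>p\<in>UNIV. ?V p \<omega> * (real_cond_exp M (F n) (?Z p) \<omega> - ?Z p \<omega>)"
    let ?X2 = "\<lambda>\<omega>. \<Sum>i\<in>UNIV. ?V' i \<omega> * (real_cond_exp M (F n) (f_est (Suc n) i) \<omega> - f_est (Suc n) i \<omega>)"
    have X_eq: "X n = (\<lambda>\<omega>. ?X1 \<omega> + ?X2 \<omega>)"
      unfolding X_def 1 2 by (simp add: E_def e_def case_prod_unfold)
    have "AE \<omega> in M. real_cond_exp M (F n) (\<lambda>\<omega>. ?X1 \<omega> + ?X2 \<omega>) \<omega>
        = real_cond_exp M (F n) ?X1 \<omega> + real_cond_exp M (F n) ?X2 \<omega>"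
      by (intro S.real_cond_exp_add err1(1) err2(1)) auto
    moreover have "AE \<omega> in M. real_cond_exp M (F n) ?X1 \<omega> = 0" by (rule err1(2)) auto
    moreover have "AE \<omega> in M. real_cond_exp M (F n) ?X2 \<omega> = 0" by (rule err2(2)) auto
    ultimately show "AE \<omega> in M. real_cond_exp M (F n) (X n) \<omega> = 0"
      unfolding X_eq by eventually_elim (simp only: add_0)
  qed (use F_sub F_mono c_pos in auto)

  \<comment> \<open>The output and its measurability\<close>
  have \<theta>_hat_in: "\<theta>_hat \<omega> \<in> \<Theta>"
    and \<theta>_hat_le: "f i (\<theta>_hat \<omega>) \<le> 1 / real T * (\<Sum>t=1..T. f i (\<theta> t \<omega>))" if "\<omega> \<in> space M" for \<omega> i
  proof -
    have \<theta>: "\<theta> t \<omega> \<in> \<Theta>" if "t \<in> {1..T}" for t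
      using \<theta>_in[of "t - 1" \<omega>] that \<open>\<omega> \<in> space M\<close> by auto
    show "\<theta>_hat \<omega> \<in> \<Theta>" "f i (\<theta>_hat \<omega>) \<le> 1 / real T * (\<Sum>t=1..T. f i (\<theta> t \<omega>))"
      using \<theta>_hat uniform_average(1)[where \<theta> = "\<lambda>t. \<theta> t \<omega>", OF T \<Theta>(3) \<theta>]
        uniform_average(2)[where \<theta> = "\<lambda>t. \<theta> t \<omega>", OF T \<Theta>(3) \<theta> f_convex]
        adaptive_average(1)[where \<theta> = "\<lambda>t. \<theta> t \<omega>" and f = f, OF T \<Theta>(3) \<theta>]
        adaptive_average(2)[where \<theta> = "\<lambda>t. \<theta> t \<omega>" and f = f, OF T \<Theta>(3) \<theta> f_convex]
      by auto
  qed
  have f_cont: "continuous_on \<Theta> (f i)" for i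
    using f_diff by (intro differentiable_imp_continuous_on) (auto simp: differentiable_on_def intro: differentiable_at_withinI)
  have \<theta>_M: "\<theta> t \<in> borel_measurable M" if "t \<in> {1..T}" for t
    using measurable_from_subalg[OF F_sub \<theta>_meas, of "t - 1"] that by auto
  have f_\<theta>_M: "(\<lambda>\<omega>. f i (\<theta> t \<omega>)) \<in> borel_measurable M" if "t \<in> {1..T}" for t i
    using \<theta>_in[of "t - 1"] that
    by (intro borel_measurable_compose_continuous_on[OF f_cont \<theta>_M]) auto
  have \<theta>_hat_M: "\<theta>_hat \<in> borel_measurable M"
    using \<theta>_hat
  proof
    assume "\<theta>_hat = (\<lambda>\<omega>. uniform_average (\<lambda>t. \<theta> t \<omega>) T)"
    moreover have "(\<lambda>\<omega>. \<Sum>t=1..T. \<theta> t \<omega>) \<in> borel_measurable M"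
      using \<theta>_M by (intro borel_measurable_sum)
    ultimately show ?thesis by (simp add: uniform_average_def)
  next
    assume "\<theta>_hat = (\<lambda>\<omega>. adaptive_average f (\<lambda>t. \<theta> t \<omega>) T)"
    then show ?thesis using adaptive_average_measurable[OF f_\<theta>_M \<theta>_M] by simp
  qed
  have TCH_M [measurable]: "(\<lambda>\<omega>. TCH f w (\<theta>_hat \<omega>)) \<in> borel_measurable M"
  proof -
    have "(\<lambda>\<omega>. f i (\<theta>_hat \<omega>)) \<in> borel_measurable M" for i
      by (rule borel_measurable_compose_continuous_on[OF f_cont \<theta>_hat_M \<theta>_hat_in])
    then show ?thesis unfolding TCH_def by (intro borel_measurable_Max) auto
  qed

  \<comment> \<open>From the duality gap to the confidence bound\<close>
  let ?gap = "\<lambda>\<omega>. TCH f w (\<theta>_hat \<omega>) - (INF x\<in>\<Theta>. TCH f w x)"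
  let ?s\<theta> = "sqrt (20 * D_\<theta> * C_\<theta> * L\<^sup>2 / (\<mu>_\<theta> * real T))"
  let ?slam = "sqrt (20 * D_lam * C_lam * U\<^sup>2 / (\<mu>_lam * real T))"
  \<comment> \<open>The deviation whose Azuma-Hoeffding tail is exactly \<gamma>; divided by
    \<open>T\<close> it is the last term of the claim.\<close>
  let ?\<epsilon> = "c * sqrt (2 * real T * ln (1 / \<gamma>))"
  let ?S = "\<lambda>\<omega>. \<Sum>n<T. X n \<omega>"
  have "AE \<omega> in M. \<forall>n\<in>{..<T}. G n \<omega> = (\<Sum>i\<in>UNIV. (lam (Suc n) \<omega> $ i * w $ i) *\<^sub>R gradient (f i) (\<theta> (Suc n) \<omega>))"
    "AE \<omega> in M. \<forall>n\<in>{..<T}. H n \<omega> = - (\<chi> i. w $ i * f i (\<theta> (Suc n) \<omega>))"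
    using AE_G AE_H by (auto intro!: AE_finite_allI)
  then have gap_le: "AE \<omega> in M. ?gap \<omega> \<le> ?s\<theta> + ?slam + 1 / real T * ?S \<omega>"
    using regret_\<theta> regret_lam D_\<theta> D_lam AE_space
  proof eventually_elim
    case (elim \<omega>)
    have star: "\<theta>_star \<omega> \<in> \<Theta>" "lam_star \<omega> \<in> prob_simplex"
      using \<theta>_star[OF elim(7)] lam_star[OF elim(7)] by (auto simp: is_arg_min_def is_arg_max_def)
    have it: "\<theta> t \<omega> \<in> \<Theta>" "lam t \<omega> \<in> prob_simplex" if "t \<in> {1..T}" for t
      using \<theta>_in[of "t - 1" \<omega>] lam_in[of "t - 1" \<omega>] that elim(7) by auto
    have "?gap \<omega> \<le> 1 / real T * ((\<Sum>t=1..T. (\<Sum>i\<in>UNIV. (lam t \<omega> $ i * w $ i) *\<^sub>R gradient (f i) (\<theta> t \<omega>)) \<bullet> (\<theta> t \<omega> - \<theta>_star \<omega>))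
        + (\<Sum>t=1..T. - (\<chi> i. w $ i * f i (\<theta> t \<omega>)) \<bullet> (lam t \<omega> - lam_star \<omega>)))"
      by (rule TCH_gap_le[OF T w \<Theta>(1) f_convex f_diff it \<theta>_hat_le[OF elim(7)] \<theta>_star[OF elim(7)] lam_star[OF elim(7)]])
    also have "\<dots> = 1 / real T * ((\<Sum>n<T. G n \<omega> \<bullet> (\<theta> (Suc n) \<omega> - \<theta>_star \<omega>))
        + (\<Sum>n<T. H n \<omega> \<bullet> (lam (Suc n) \<omega> - lam_star \<omega>)))"
      using elim(1,2) by (simp only: One_nat_def sum.atLeast1_atMost_eq[unfolded One_nat_def]) simp
    also have "\<dots> \<le> 1 / real T * (real T * ?s\<theta> + real T * ?slam + ?S \<omega>)"
    proof (rule mult_left_mono)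
      \<comment> \<open>The regret bound covers all admissible \<open>z\<close> at this \<omega>, in
        particular the point \<open>\<theta>_star \<omega>\<close> that belongs to it.\<close>
      have "(\<Sum>n<T. G n \<omega> \<bullet> (\<theta> (Suc n) \<omega> - \<theta>_star \<omega>)) \<le> real T * ?s\<theta>
          + (\<Sum>n<T. (G n \<omega> - g_\<theta> (Suc n) \<omega>) \<bullet> (\<theta> (Suc n) \<omega> - u n \<omega>))"
        using elim(3,5) star(1) \<theta>1(2)[OF elim(7)] by (simp add: mult.assoc)
      moreover have "(\<Sum>n<T. H n \<omega> \<bullet> (lam (Suc n) \<omega> - lam_star \<omega>)) \<le> real T * ?slam
          + (\<Sum>n<T. (H n \<omega> - - g_lam (Suc n) \<omega>) \<bullet> (lam (Suc n) \<omega> - v n \<omega>))"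
        using elim(4,6) star(2) lam1(2)[OF elim(7)] by (simp add: mult.assoc)
      ultimately show "(\<Sum>n<T. G n \<omega> \<bullet> (\<theta> (Suc n) \<omega> - \<theta>_star \<omega>))
          + (\<Sum>n<T. H n \<omega> \<bullet> (lam (Suc n) \<omega> - lam_star \<omega>)) \<le> real T * ?s\<theta> + real T * ?slam + ?S \<omega>"
        unfolding X_def sum.distrib by linarith
    qed simp
    also have "\<dots> = ?s\<theta> + ?slam + 1 / real T * ?S \<omega>" using T0 by (simp add: field_simps)
    finally show ?case .
  qed
  have S_M [measurable]: "?S \<in> borel_measurable M"
    using measurable_from_subalg[OF F_sub sum_measurable] by blast
  have "prob {\<omega> \<in> space M. ?\<epsilon> \<le> ?S \<omega>} \<le> exp (- ?\<epsilon>\<^sup>2 / (2 * real T * c\<^sup>2))"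
    using c_pos \<gamma> by (intro azuma_hoeffding T) simp
  also have "\<dots> = \<gamma>" by (rule ln_confidence(1)[OF T c_pos \<gamma>])
  finally have "1 - \<gamma> \<le> 1 - prob {\<omega> \<in> space M. ?\<epsilon> \<le> ?S \<omega>}" by simp
  also have "\<dots> = prob {\<omega> \<in> space M. \<not> ?\<epsilon> \<le> ?S \<omega>}"
    by (rule prob_neg[symmetric]) measurable
  also have "\<dots> \<le> prob {\<omega> \<in> space M. ?gap \<omega> \<le> ?s\<theta> + ?slam
      + 4 * (real CARD('d) * R * L + U) * sqrt (2 / real T * ln (1 / \<gamma>))}"
  \<comment> \<open>The gap bound holds almost everywhere, hence so does the inclusion of events;
    monotonicity also asks that the larger event be measurable, which is where \<open>TCH_M\<close>
    enters.\<close>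
  proof (rule finite_measure_mono_AE)
    show "AE \<omega> in M. \<omega> \<in> {\<omega> \<in> space M. \<not> ?\<epsilon> \<le> ?S \<omega>} \<longrightarrow> \<omega> \<in> {\<omega> \<in> space M. ?gap \<omega> \<le> ?s\<theta> + ?slam
      + 4 * (real CARD('d) * R * L + U) * sqrt (2 / real T * ln (1 / \<gamma>))}"
      using gap_le
    proof eventually_elim
      case (elim \<omega>)
      have "1 / real T * ?S \<omega> \<le> c * sqrt (2 / real T * ln (1 / \<gamma>))" if "\<not> ?\<epsilon> \<le> ?S \<omega>"
      proof -
        have "1 / real T * ?S \<omega> \<le> 1 / real T * ?\<epsilon>" using that by (intro mult_left_mono) auto
        then show ?thesis using ln_confidence(2)[OF T c_pos \<gamma>] by linarith
      qed
      then show ?case using elim unfolding c_def by auto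
    qed
  qed measurable
  finally show ?thesis .
qed

end
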